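(* Let $E$ and $F$ be separable complex Banach spaces with $\dim F\geq 2$ and let $T\in\mathcal{B}(E)$. Let $I$ denote the identity operator on $F$. The following are equivalent: (i) $T$ satisfies the supercyclicity criterion. (ii) $T\widehat{\otimes}I: E\widehat{\otimes}_{\pi}F\to E\widehat{\otimes}_{\pi}F$ is supercyclic for the projective tensor norm $\pi$. (iii) $T\oplus T: E\oplus E\to E\oplus E$ is supercyclic.
   Context: $\mathcal{B}(X)$ is the algebra of bounded linear operators on a Banach space $X$. Projective tensor product: for normed spaces $E,F$, the projective norm on the algebraic tensor product $E\otimes F$ is $\Pi(z)=\inf\{\sum_{j=1}^{n}\|x_j\|\,\|y_j\| : z=\sum_{j=1}^{n}x_j\otimes y_j\}$; the completion of $E\otimes F$ under this norm is denoted $E\widehat{\otimes}_{\pi}F$. $T\widehat{\otimes}I$ is the unique bounded linear operator on $E\widehat{\otimes}_{\pi}F$ with $(T\widehat{\otimes}I)(x\otimes y)=Tx\otimes y$. The operator $T\oplus T$ is $(x,y)\mapsto(Tx,Ty)$ on the Banach space direct sum $E\oplus E$. Supercyclic: a bounded linear operator $T$ on a Banach space $X$ is supercyclic if there is $x\in X$ such that $\{\alpha T^{n}x:\alpha\in\mathbb{C},\,n\in\mathbb{N}\}$ is dense in $X$. Supercyclicity criterion: $T\in\mathcal{B}(X)$ satisfies it if there exist two dense subsets $D_1,D_2$ of $X$, a sequence $(n_k)_{k\ge 0}$ of positive integers, and mappings $S_{n_k}:D_2\to X$ such that (i) $\|T^{n_k}x\|\,\|S_{n_k}y\|\to 0$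 for every $x\in D_1$ and $y\in D_2$; (ii) $T^{n_k}S_{n_k}y\to y$ for every $y\in D_2$. *)

theory Defs
  imports "HOL-Analysis.Analysis"
begin

section \<open>Complex Banach spaces\<close>

class scaleC =
  fixes scaleC :: "complex \<Rightarrow> 'a \<Rightarrow> 'a"  (infixr \<open>*\<^sub>C\<close> 75)

class complex_vector = real_vector + scaleC +
  assumes scaleC_add_right: "a *\<^sub>C (x + y) = a *\<^sub>C x + a *\<^sub>C y"
    and scaleC_add_left: "(a + b) *\<^sub>C x = a *\<^sub>C x + b *\<^sub>C x"
    and scaleC_scaleC: "a *\<^sub>C b *\<^sub>C x = (a * b) *\<^sub>C x"
    and scaleC_one: "1 *\<^sub>C x = x"
    and scaleR_scaleC: "r *\<^sub>R x = complex_of_real r *\<^sub>C x"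

class complex_normed_vector = complex_vector + real_normed_vector +
  assumes norm_scaleC: "norm (a *\<^sub>C x) = cmod a * norm x"

class complex_banach = complex_normed_vector + banach

global_interpretation complex_vector:
  vector_space "scaleC :: complex \<Rightarrow> 'a \<Rightarrow> 'a::complex_vector"
  by standard (simp_all add: scaleC_add_right scaleC_add_left scaleC_scaleC scaleC_one)

definition clinear :: "('a::complex_vector \<Rightarrow> 'b::complex_vector) \<Rightarrow> bool" where
  "clinear = Vector_Spaces.linear scaleC scaleC"

definition bounded_clinear :: "('a::complex_normed_vector \<Rightarrow> 'b::complex_normed_vector) \<Rightarrow> bool" where
  "bounded_clinear f \<longleftrightarrow> clinear f \<and> (\<exists>K. \<forall>x. norm (f x) \<le> norm x * K)"

lemma clinear_iff:
  "clinear f \<longleftrightarrow> (\<forall>x y. f (x + y) = f x + f y) \<and> (\<forall>c x. f (c *\<^sub>C x) = c *\<^sub>C f x)"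
  unfolding clinear_def module_hom_iff_linear[symmetric] module_hom_iff
  by (auto intro: complex_vector.module_axioms)

lemma bounded_clinear_imp_bounded_linear: "bounded_clinear f \<Longrightarrow> bounded_linear f"
  unfolding bounded_clinear_def clinear_iff
  by (auto intro!: bounded_linear_intro simp: scaleR_scaleC)

instantiation complex :: complex_banach
begin

definition scaleC_complex_def: "scaleC = ((*) :: complex \<Rightarrow> complex \<Rightarrow> complex)"

instance
  by standard (simp_all add: scaleC_complex_def algebra_simps scaleR_conv_of_real norm_mult)

end

text \<open>
  The direct sum of two spaces is the product type.  Its library norm is the Euclidean
  combination of the two norms, which is equivalent to the other usual direct sum norms.
\<close>

instantiation prod :: (complex_vector, complex_vector) complex_vector
begin

definition scaleC_prod_def: "c *\<^sub>C z = (c *\<^sub>C fst z, c *\<^sub>C snd z)"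

instance
  by standard
    (simp_all add: scaleC_prod_def scaleC_add_right scaleC_add_left scaleC_scaleC scaleC_one
      scaleR_prod_def scaleR_scaleC prod_eq_iff)

end

instance prod :: (complex_normed_vector, complex_normed_vector) complex_normed_vector
  by standard
    (simp add: scaleC_prod_def norm_prod_def norm_scaleC power_mult_distrib real_sqrt_mult
      flip: distrib_left)

instance prod :: (complex_banach, complex_banach) complex_banach ..


section \<open>Supercyclicity\<close>

definition supercyclic :: "('a::complex_banach \<Rightarrow> 'a) \<Rightarrow> bool" where
  "supercyclic T \<longleftrightarrow> bounded_clinear T \<and>
     (\<exists>x. closure {\<alpha> *\<^sub>C (T ^^ n) x | \<alpha> n. True} = UNIV)"

text \<open>
  The times \<open>n k\<close> are arbitrary positive integers; they are not required to be increasing.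
\<close>

definition supercyclicity_criterion :: "('a::complex_banach \<Rightarrow> 'a) \<Rightarrow> bool" where
  "supercyclicity_criterion T \<longleftrightarrow> bounded_clinear T \<and>
     (\<exists>(D1 :: 'a set) (D2 :: 'a set) (n :: nat \<Rightarrow> nat) (S :: nat \<Rightarrow> 'a \<Rightarrow> 'a).
        closure D1 = UNIV \<and> closure D2 = UNIV \<and> (\<forall>k. 0 < n k) \<and>
        (\<forall>x\<in>D1. \<forall>y\<in>D2. (\<lambda>k. norm ((T ^^ n k) x) * norm (S (n k) y)) \<longlonglongrightarrow> 0) \<and>
        (\<forall>y\<in>D2. (\<lambda>k. (T ^^ n k) (S (n k) y)) \<longlonglongrightarrow> y))"


section \<open>The algebraic tensor product\<close>

definition cbilinear ::
  "('a::complex_vector \<Rightarrow> 'b::complex_vector \<Rightarrow> 'c::complex_vector) \<Rightarrow> bool" where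
  "cbilinear B \<longleftrightarrow> (\<forall>y. clinear (\<lambda>x. B x y)) \<and> (\<forall>x. clinear (B x))"

lemma cbilinear_iff:
  "cbilinear B \<longleftrightarrow>
     (\<forall>x x' y. B (x + x') y = B x y + B x' y) \<and> (\<forall>c x y. B (c *\<^sub>C x) y = c *\<^sub>C B x y) \<and>
     (\<forall>x y y'. B x (y + y') = B x y + B x y') \<and> (\<forall>c x y. B x (c *\<^sub>C y) = c *\<^sub>C B x y)"
  unfolding cbilinear_def clinear_iff by auto

definition formal_sum :: "('a \<Rightarrow> 'b \<Rightarrow> complex) \<Rightarrow> ('a \<times> 'b) list \<Rightarrow> complex" where
  "formal_sum B ps = (\<Sum>(x, y)\<leftarrow>ps. B x y)"

lemma formal_sum_simps [simp]:
  "formal_sum B [] = 0"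
  "formal_sum B (p # ps) = B (fst p) (snd p) + formal_sum B ps"
  "formal_sum B (ps @ qs) = formal_sum B ps + formal_sum B qs"
  by (simp_all add: formal_sum_def case_prod_unfold)

lemma formal_sum_map_fst:
  "formal_sum B (map (\<lambda>(x, y). (f x, y)) ps) = formal_sum (\<lambda>x. B (f x)) ps"
  by (induction ps) auto

lemma formal_sum_scale:
  "cbilinear B \<Longrightarrow> formal_sum (\<lambda>x. B (c *\<^sub>C x)) ps = c * formal_sum B ps"
  by (induction ps) (auto simp: cbilinear_iff scaleC_complex_def algebra_simps)

text \<open>
  The list of pairs $(x_j, y_j)$ stands for $\sum_j x_j \otimes y_j$, and $x \otimes y$ is the
  evaluation of bilinear forms at $(x, y)$: two lists give the same tensor iff they agree on all
  bilinear forms (not only the bounded ones).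
\<close>

definition tensor_eq ::
  "('a::complex_vector \<times> 'b::complex_vector) list \<Rightarrow> ('a \<times> 'b) list \<Rightarrow> bool" where
  "tensor_eq ps qs \<longleftrightarrow> (\<forall>B. cbilinear B \<longrightarrow> formal_sum B ps = formal_sum B qs)"

quotient_type (overloaded) ('a, 'b) atensor =
    "('a::complex_vector \<times> 'b::complex_vector) list" / tensor_eq
  by (rule equivpI) (auto intro!: reflpI sympI transpI simp: tensor_eq_def)

instantiation atensor :: (complex_vector, complex_vector) complex_vector
begin

lift_definition zero_atensor :: "('a, 'b) atensor" is "[]" .

lift_definition plus_atensor :: "('a, 'b) atensor \<Rightarrow> ('a, 'b) atensor \<Rightarrow> ('a, 'b) atensor"
  is "(@)" by (simp add: tensor_eq_def)

lift_definition scaleC_atensor :: "complex \<Rightarrow> ('a, 'b) atensor \<Rightarrow> ('a, 'b) atensor"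
  is "\<lambda>c. map (\<lambda>(x, y). (c *\<^sub>C x, y))"
  by (simp add: tensor_eq_def formal_sum_map_fst formal_sum_scale)

definition uminus_atensor :: "('a, 'b) atensor \<Rightarrow> ('a, 'b) atensor" where
  "- z = (- 1) *\<^sub>C (z :: ('a, 'b) atensor)"

definition minus_atensor :: "('a, 'b) atensor \<Rightarrow> ('a, 'b) atensor \<Rightarrow> ('a, 'b) atensor" where
  "z - w = z + - (w :: ('a, 'b) atensor)"

definition scaleR_atensor :: "real \<Rightarrow> ('a, 'b) atensor \<Rightarrow> ('a, 'b) atensor" where
  "r *\<^sub>R z = complex_of_real r *\<^sub>C (z :: ('a, 'b) atensor)"

instance
proof
  fix a b c :: "('a, 'b) atensor" and k l :: complex and r s :: real
  show assoc: "a + b + c = a + (b + c)" by transfer (simp add: tensor_eq_def)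
  show "a + b = b + a" by transfer (simp add: tensor_eq_def)
  show zero: "0 + a = a" by transfer (simp add: tensor_eq_def)
  show "- a + a = 0" unfolding uminus_atensor_def
    by transfer (simp add: tensor_eq_def formal_sum_map_fst formal_sum_scale[where c = "- 1", simplified])
  show "a - b = a + - b" by (simp add: minus_atensor_def)
  show add_r: "k *\<^sub>C (a + b) = k *\<^sub>C a + k *\<^sub>C b" for k
    by transfer (simp add: tensor_eq_def)
  show add_l: "(k + l) *\<^sub>C a = k *\<^sub>C a + l *\<^sub>C a" for k l
    by transfer (simp add: tensor_eq_def formal_sum_map_fst formal_sum_scale distrib_right)
  show mult: "k *\<^sub>C l *\<^sub>C a = (k * l) *\<^sub>C a" for k l
    by transfer (simp add: tensor_eq_def formal_sum_map_fst formal_sum_scale mult.assoc del: map_map)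
  show one: "1 *\<^sub>C a = a"
    by transfer (simp add: tensor_eq_def formal_sum_map_fst formal_sum_scale)
  show "r *\<^sub>R a = complex_of_real r *\<^sub>C a" for r by (simp add: scaleR_atensor_def)
  show "r *\<^sub>R (a + b) = r *\<^sub>R a + r *\<^sub>R b" by (simp add: scaleR_atensor_def add_r)
  show "(r + s) *\<^sub>R a = r *\<^sub>R a + s *\<^sub>R a" by (simp add: scaleR_atensor_def add_l)
  show "r *\<^sub>R s *\<^sub>R a = (r * s) *\<^sub>R a" by (simp add: scaleR_atensor_def mult)
  show "1 *\<^sub>R a = a" by (simp add: scaleR_atensor_def one)
qed

end

lift_definition atensor :: "'a::complex_vector \<Rightarrow> 'b::complex_vector \<Rightarrow> ('a, 'b) atensor"
  is "\<lambda>x y. [(x, y)]" .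

lemma abs_atensor_eq_sum: "abs_atensor ps = (\<Sum>(x, y)\<leftarrow>ps. atensor x y)"
proof (induction ps)
  case Nil
  show ?case by (simp add: zero_atensor.abs_eq)
next
  case (Cons p ps)
  have "abs_atensor (p # ps) = atensor (fst p) (snd p) + abs_atensor ps"
    by (simp add: atensor.abs_eq plus_atensor.abs_eq)
  with Cons show ?case by (simp add: case_prod_unfold)
qed

lemma atensor_representation:
  obtains ps where "z = (\<Sum>(x, y)\<leftarrow>ps. atensor x y)"
  by (metis Quotient3_abs_rep Quotient3_atensor abs_atensor_eq_sum)

lemma cbilinear_atensor: "cbilinear atensor"
  unfolding cbilinear_iff
  by (intro conjI allI; transfer)
    (simp_all add: tensor_eq_def cbilinear_iff scaleC_complex_def)


lemma atensor_scaleC_left: "atensor (c *\<^sub>C x) y = c *\<^sub>C atensor x y"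
  using cbilinear_atensor unfolding cbilinear_iff by blast

lifting_forget atensor.lifting


section \<open>The projective norm\<close>

definition proj_norm ::
  "('a::complex_normed_vector, 'b::complex_normed_vector) atensor \<Rightarrow> real" where
  "proj_norm z =
     Inf {(\<Sum>(x, y)\<leftarrow>ps. norm x * norm y) | ps. z = (\<Sum>(x, y)\<leftarrow>ps. atensor x y)}"

lemma cost_nonneg: "0 \<le> (\<Sum>(x, y)\<leftarrow>ps. norm x * norm y)"
  by (rule sum_list_nonneg) auto

lemma proj_norm_le: "proj_norm (\<Sum>(x, y)\<leftarrow>ps. atensor x y) \<le> (\<Sum>(x, y)\<leftarrow>ps. norm x * norm y)"
  unfolding proj_norm_def
  by (rule cInf_lower) (auto intro!: bdd_belowI[of _ 0] cost_nonneg)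

lemma proj_norm_approx:
  assumes "proj_norm z < r"
  obtains ps where "z = (\<Sum>(x, y)\<leftarrow>ps. atensor x y)" "(\<Sum>(x, y)\<leftarrow>ps. norm x * norm y) < r"
proof -
  have "{(\<Sum>(x, y)\<leftarrow>ps. norm x * norm y) | ps. z = (\<Sum>(x, y)\<leftarrow>ps. atensor x y)} \<noteq> {}"
    using atensor_representation[of z] by blast
  from cInf_lessD[OF this assms[unfolded proj_norm_def]] that show ?thesis by blast
qed

lemma proj_norm_nonneg: "0 \<le> proj_norm z"
  unfolding proj_norm_def
  using atensor_representation[of z] by (intro cInf_greatest) (auto intro: cost_nonneg)

lemma proj_norm_atensor_le: "proj_norm (atensor x y) \<le> norm x * norm y"
  using proj_norm_le[of "[(x, y)]"] by simp

lemma proj_norm_zero [simp]: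
  "proj_norm (0 :: ('a::complex_normed_vector, 'b::complex_normed_vector) atensor) = 0"
  using proj_norm_le[of "[] :: ('a \<times> 'b) list"] proj_norm_nonneg[of "0 :: ('a, 'b) atensor"]
  by simp

lemma proj_norm_triangle: "proj_norm (z + w) \<le> proj_norm z + proj_norm w"
proof (rule field_le_epsilon)
  fix e :: real assume "0 < e"
  obtain ps where ps: "z = (\<Sum>(x, y)\<leftarrow>ps. atensor x y)"
    "(\<Sum>(x, y)\<leftarrow>ps. norm x * norm y) < proj_norm z + e / 2"
    using proj_norm_approx[of z "proj_norm z + e / 2"] \<open>0 < e\<close> by auto
  obtain qs where qs: "w = (\<Sum>(x, y)\<leftarrow>qs. atensor x y)"
    "(\<Sum>(x, y)\<leftarrow>qs. norm x * norm y) < proj_norm w + e / 2"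
    using proj_norm_approx[of w "proj_norm w + e / 2"] \<open>0 < e\<close> by auto
  show "proj_norm (z + w) \<le> proj_norm z + proj_norm w + e"
    using proj_norm_le[of "ps @ qs"] ps qs by simp
qed

lemma proj_norm_map_fst_le:
  assumes "\<And>x. norm (f x) \<le> norm x * K" "0 \<le> K"
    and "\<And>ps. g (\<Sum>(x, y)\<leftarrow>ps. atensor x y) = (\<Sum>(x, y)\<leftarrow>ps. atensor (f x) y)"
  shows "proj_norm (g z) \<le> K * proj_norm z"
proof -
  have *: "proj_norm (g z) \<le> K * r" if r: "proj_norm z < r" for r
  proof -
    obtain ps where ps: "z = (\<Sum>(x, y)\<leftarrow>ps. atensor x y)"
      "(\<Sum>(x, y)\<leftarrow>ps. norm x * norm y) < r"
      using proj_norm_approx[OF r] .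
    have "proj_norm (g z) \<le> (\<Sum>(x, y)\<leftarrow>map (\<lambda>(x, y). (f x, y)) ps. norm x * norm y)"
      using proj_norm_le[of "map (\<lambda>(x, y). (f x, y)) ps"] unfolding ps(1) assms(3)
      by (simp add: comp_def case_prod_unfold)
    also have "\<dots> \<le> (\<Sum>(x, y)\<leftarrow>ps. K * (norm x * norm y))"
    proof (induction ps)
      case (Cons p ps)
      have "norm (f (fst p)) * norm (snd p) \<le> K * (norm (fst p) * norm (snd p))"
        using mult_right_mono[OF assms(1)[of "fst p"], of "norm (snd p)"] by (simp add: mult_ac)
      with Cons show ?case by (simp add: case_prod_unfold)
    qed simp
    also have "\<dots> = K * (\<Sum>(x, y)\<leftarrow>ps. norm x * norm y)"
      by (simp add: sum_list_const_mult case_prod_unfold)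
    also have "\<dots> \<le> K * r" using ps(2) \<open>0 \<le> K\<close> by (simp add: mult_left_mono)
    finally show ?thesis .
  qed
  show ?thesis
  proof (rule tendsto_lowerbound)
    show "((\<lambda>r. K * r) \<longlongrightarrow> K * proj_norm z) (at_right (proj_norm z))"
      by (intro tendsto_intros)
    show "\<forall>\<^sub>F r in at_right (proj_norm z). proj_norm (g z) \<le> K * r"
      using * by (auto simp: eventually_at_filter)
  qed simp
qed

lemma proj_norm_scaleC: "proj_norm (c *\<^sub>C z) = cmod c * proj_norm z"
proof -
  have sum: "c *\<^sub>C (\<Sum>(x, y)\<leftarrow>ps. atensor x y) = (\<Sum>(x, y)\<leftarrow>ps. atensor (c *\<^sub>C x) y)"
    for c :: complex and ps :: "('a \<times> 'b) list"
    by (induction ps) (auto simp: atensor_scaleC_left scaleC_add_right)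
  have le: "proj_norm (c *\<^sub>C z) \<le> cmod c * proj_norm z" for c and z :: "('a, 'b) atensor"
    by (rule proj_norm_map_fst_le[where f = "scaleC c"]) (simp_all add: norm_scaleC sum)
  show ?thesis
  proof (cases "c = 0")
    case False
    have "cmod c * proj_norm z = cmod c * proj_norm (inverse c *\<^sub>C c *\<^sub>C z)"
      using False by (simp add: scaleC_scaleC scaleC_one)
    also have "\<dots> \<le> cmod c * (cmod (inverse c) * proj_norm (c *\<^sub>C z))"
      by (intro mult_left_mono le) auto
    also have "\<dots> = proj_norm (c *\<^sub>C z)" using False by (simp add: norm_inverse)
    finally show ?thesis using le[of c z] by simp
  qed (use le[of 0 z] proj_norm_nonneg[of "0 *\<^sub>C z"] in simp)
qed

lemma proj_norm_uminus: "proj_norm (- z) = proj_norm z"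
  using proj_norm_scaleC[of "-1" z] by simp

lemma proj_norm_minus_commute: "proj_norm (z - w) = proj_norm (w - z)"
  using proj_norm_uminus[of "z - w"] by simp

lemma proj_norm_triangle_sub: "\<bar>proj_norm z - proj_norm w\<bar> \<le> proj_norm (z - w)"
  using proj_norm_triangle[of "z - w" w] proj_norm_triangle[of "w - z" z]
    proj_norm_minus_commute[of z w] by simp


section \<open>The completed projective tensor product\<close>

text \<open>
  The completion consists of the Cauchy sequences modulo null sequences.  That the seminorm
  \<^const>\<open>proj_norm\<close> is in fact a norm (which depends on the Hahn--Banach theorem) plays no role
  in the construction.
\<close>

definition proj_Cauchy ::
  "(nat \<Rightarrow> ('a::complex_normed_vector, 'b::complex_normed_vector) atensor) \<Rightarrow> bool" where
  "proj_Cauchy X \<longleftrightarrow> (\<forall>e>0. \<exists>N. \<forall>m\<ge>N. \<forall>n\<ge>N. proj_norm (X m - X n) < e)"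

definition proj_equiv ::
  "(nat \<Rightarrow> ('a::complex_normed_vector, 'b::complex_normed_vector) atensor) \<Rightarrow>
   (nat \<Rightarrow> ('a, 'b) atensor) \<Rightarrow> bool" where
  "proj_equiv X Y \<longleftrightarrow> proj_Cauchy X \<and> proj_Cauchy Y \<and> (\<lambda>n. proj_norm (X n - Y n)) \<longlonglongrightarrow> 0"

lemma proj_null_le:
  assumes "(\<lambda>n. f n) \<longlonglongrightarrow> (0::real)" "\<And>n. proj_norm (X n) \<le> f n"
  shows "(\<lambda>n. proj_norm (X n)) \<longlonglongrightarrow> 0"
  using assms by (intro tendsto_sandwich[OF _ _ tendsto_const assms(1)])
    (auto simp: proj_norm_nonneg)

lemma proj_null_add:
  assumes "(\<lambda>n. proj_norm (X n)) \<longlonglongrightarrow> 0" "(\<lambda>n. proj_norm (Y n)) \<longlonglongrightarrow> 0"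
  shows "(\<lambda>n. proj_norm (X n + Y n)) \<longlonglongrightarrow> 0"
  using tendsto_add[OF assms]
  by (intro proj_null_le[where f = "\<lambda>n. proj_norm (X n) + proj_norm (Y n)"])
    (auto simp: proj_norm_triangle)

lemma part_equivp_proj_equiv: "part_equivp proj_equiv"
proof (rule part_equivpI)
  have "proj_equiv (\<lambda>_. 0) (\<lambda>_. 0)" by (simp add: proj_equiv_def proj_Cauchy_def)
  then show "\<exists>X. proj_equiv X X" by blast
  show "symp proj_equiv"
    by (auto intro!: sympI simp: proj_equiv_def proj_norm_minus_commute)
  show "transp proj_equiv"
  proof (rule transpI)
    fix X Y Z
    assume "proj_equiv X Y" "proj_equiv Y Z"
    then show "proj_equiv X Z"
      using proj_null_add[of "\<lambda>n. X n - Y n" "\<lambda>n. Y n - Z n"] by (simp add: proj_equiv_def)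
  qed
qed

quotient_type (overloaded) ('a, 'b) ptensor =
    "nat \<Rightarrow> ('a::complex_normed_vector, 'b::complex_normed_vector) atensor" / partial: proj_equiv
  by (rule part_equivp_proj_equiv)

lemma proj_Cauchy_const [simp]: "proj_Cauchy (\<lambda>_. z)"
  by (simp add: proj_Cauchy_def)

lemma proj_Cauchy_add:
  assumes "proj_Cauchy X" "proj_Cauchy Y"
  shows "proj_Cauchy (\<lambda>n. X n + Y n)"
  unfolding proj_Cauchy_def
proof (intro allI impI)
  fix e :: real assume "0 < e"
  then obtain M N where
    M: "\<And>m n. m \<ge> M \<Longrightarrow> n \<ge> M \<Longrightarrow> proj_norm (X m - X n) < e / 2" and
    N: "\<And>m n. m \<ge> N \<Longrightarrow> n \<ge> N \<Longrightarrow> proj_norm (Y m - Y n) < e / 2"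
    using assms unfolding proj_Cauchy_def by (meson half_gt_zero)
  have "proj_norm (X m + Y m - (X n + Y n)) < e" if "m \<ge> max M N" "n \<ge> max M N" for m n
    using M[of m n] N[of m n] that proj_norm_triangle[of "X m - X n" "Y m - Y n"]
    by (simp add: add_diff_add)
  then show "\<exists>K. \<forall>m\<ge>K. \<forall>n\<ge>K. proj_norm (X m + Y m - (X n + Y n)) < e" by blast
qed

lemma proj_Cauchy_bound:
  assumes "proj_Cauchy X" "\<And>m n. proj_norm (Y m - Y n) \<le> K * proj_norm (X m - X n)"
  shows "proj_Cauchy Y"
  unfolding proj_Cauchy_def
proof (intro allI impI)
  fix e :: real assume "0 < e"
  then have "0 < e / (\<bar>K\<bar> + 1)" by (intro divide_pos_pos) auto
  then obtain N where N: "\<And>m n. m \<ge> N \<Longrightarrow> n \<ge> N \<Longrightarrow> proj_norm (X m - X n) < e / (\<bar>K\<bar> + 1)"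
    using assms(1) unfolding proj_Cauchy_def by meson
  have "proj_norm (Y m - Y n) < e" if "m \<ge> N" "n \<ge> N" for m n
  proof -
    have "proj_norm (Y m - Y n) \<le> (\<bar>K\<bar> + 1) * proj_norm (X m - X n)"
      by (rule order_trans[OF assms(2)]) (intro mult_right_mono, auto simp: proj_norm_nonneg)
    also have "\<dots> < e" using N[OF that] by (simp add: pos_less_divide_eq mult.commute)
    finally show ?thesis .
  qed
  then show "\<exists>N. \<forall>m\<ge>N. \<forall>n\<ge>N. proj_norm (Y m - Y n) < e" by blast
qed

lemma proj_Cauchy_scaleC: "proj_Cauchy X \<Longrightarrow> proj_Cauchy (\<lambda>n. c *\<^sub>C X n)"
  by (erule proj_Cauchy_bound[where K = "cmod c"])
    (simp flip: complex_vector.scale_right_diff_distrib add: proj_norm_scaleC)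

lemma proj_Cauchy_norm: "proj_Cauchy X \<Longrightarrow> convergent (\<lambda>n. proj_norm (X n))"
  unfolding proj_Cauchy_def
  by (intro real_Cauchy_convergent CauchyI)
    (metis order_le_less_trans proj_norm_triangle_sub real_norm_def)

lemma proj_Cauchy_norm_lim:
  "proj_Cauchy X \<Longrightarrow> (\<lambda>n. proj_norm (X n)) \<longlonglongrightarrow> lim (\<lambda>n. proj_norm (X n))"
  using proj_Cauchy_norm convergent_LIMSEQ_iff by blast

lemma proj_equiv_scaleC:
  assumes "proj_equiv X Y"
  shows "proj_equiv (\<lambda>n. c *\<^sub>C X n) (\<lambda>n. c *\<^sub>C Y n)"
proof -
  have "(\<lambda>n. cmod c * proj_norm (X n - Y n)) \<longlonglongrightarrow> 0"
    using assms tendsto_mult_right_zero unfolding proj_equiv_def by blast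
  then show ?thesis
    using assms by (simp add: proj_equiv_def proj_Cauchy_scaleC proj_norm_scaleC
        flip: complex_vector.scale_right_diff_distrib)
qed

instantiation ptensor :: (complex_normed_vector, complex_normed_vector) complex_vector
begin

lift_definition zero_ptensor :: "('a, 'b) ptensor" is "\<lambda>_. 0"
  by (simp add: proj_equiv_def)

lift_definition plus_ptensor :: "('a, 'b) ptensor \<Rightarrow> ('a, 'b) ptensor \<Rightarrow> ('a, 'b) ptensor"
  is "\<lambda>X Y n. X n + Y n"
proof -
  fix X X' Y Y' :: "nat \<Rightarrow> ('a, 'b) atensor"
  assume "proj_equiv X X'" "proj_equiv Y Y'"
  then show "proj_equiv (\<lambda>n. X n + Y n) (\<lambda>n. X' n + Y' n)"
    using proj_null_add[of "\<lambda>n. X n - X' n" "\<lambda>n. Y n - Y' n"]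
    by (simp add: proj_equiv_def proj_Cauchy_add add_diff_add)
qed

lift_definition scaleC_ptensor :: "complex \<Rightarrow> ('a, 'b) ptensor \<Rightarrow> ('a, 'b) ptensor"
  is "\<lambda>c X n. c *\<^sub>C X n"
  by (rule proj_equiv_scaleC)

definition uminus_ptensor :: "('a, 'b) ptensor \<Rightarrow> ('a, 'b) ptensor" where
  "- u = (- 1) *\<^sub>C (u :: ('a, 'b) ptensor)"

definition minus_ptensor :: "('a, 'b) ptensor \<Rightarrow> ('a, 'b) ptensor \<Rightarrow> ('a, 'b) ptensor" where
  "u - v = u + - (v :: ('a, 'b) ptensor)"

definition scaleR_ptensor :: "real \<Rightarrow> ('a, 'b) ptensor \<Rightarrow> ('a, 'b) ptensor" where
  "r *\<^sub>R u = complex_of_real r *\<^sub>C (u :: ('a, 'b) ptensor)"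

instance
proof
  fix a b c :: "('a, 'b) ptensor" and k l :: complex and r s :: real
  note cauchy = proj_equiv_def proj_Cauchy_add proj_Cauchy_scaleC
  show "a + b + c = a + (b + c)" by transfer (simp add: cauchy add.assoc)
  show "a + b = b + a" by transfer (simp add: cauchy add.commute)
  show "0 + a = a" by transfer (simp add: cauchy)
  show "- a + a = 0" unfolding uminus_ptensor_def
    by transfer (simp add: proj_equiv_def)
  show "a - b = a + - b" by (simp add: minus_ptensor_def)
  show add_r: "k *\<^sub>C (a + b) = k *\<^sub>C a + k *\<^sub>C b" for k
    by transfer (simp add: cauchy scaleC_add_right)
  show add_l: "(k + l) *\<^sub>C a = k *\<^sub>C a + l *\<^sub>C a" for k l
    by transfer (simp add: cauchy scaleC_add_left)
  show mult: "k *\<^sub>C l *\<^sub>C a = (k * l) *\<^sub>C a" for k l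
    by transfer (simp add: cauchy scaleC_scaleC)
  show one: "1 *\<^sub>C a = a" by transfer (simp add: cauchy scaleC_one)
  show "r *\<^sub>R a = complex_of_real r *\<^sub>C a" for r by (simp add: scaleR_ptensor_def)
  show "r *\<^sub>R (a + b) = r *\<^sub>R a + r *\<^sub>R b" by (simp add: scaleR_ptensor_def add_r)
  show "(r + s) *\<^sub>R a = r *\<^sub>R a + s *\<^sub>R a" by (simp add: scaleR_ptensor_def add_l)
  show "r *\<^sub>R s *\<^sub>R a = (r * s) *\<^sub>R a" by (simp add: scaleR_ptensor_def mult)
  show "1 *\<^sub>R a = a" by (simp add: scaleR_ptensor_def one)
qed

end

instantiation ptensor :: (complex_normed_vector, complex_normed_vector) complex_normed_vector
begin

lift_definition norm_ptensor :: "('a, 'b) ptensor \<Rightarrow> real"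
  is "\<lambda>X. lim (\<lambda>n. proj_norm (X n))"
proof -
  fix X Y :: "nat \<Rightarrow> ('a, 'b) atensor"
  assume XY: "proj_equiv X Y"
  then have "(\<lambda>n. proj_norm (X n - Y n)) \<longlonglongrightarrow> 0" by (simp add: proj_equiv_def)
  then have "(\<lambda>n. proj_norm (X n) - proj_norm (Y n)) \<longlonglongrightarrow> 0"
    by (rule Lim_null_comparison[rotated]) (simp add: proj_norm_triangle_sub)
  moreover have "(\<lambda>n. proj_norm (X n) - proj_norm (Y n)) \<longlonglongrightarrow>
      lim (\<lambda>n. proj_norm (X n)) - lim (\<lambda>n. proj_norm (Y n))"
    using XY by (intro tendsto_diff proj_Cauchy_norm_lim) (auto simp: proj_equiv_def)
  ultimately show "lim (\<lambda>n. proj_norm (X n)) = lim (\<lambda>n. proj_norm (Y n))"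
    using LIMSEQ_unique by fastforce
qed

definition sgn_ptensor :: "('a, 'b) ptensor \<Rightarrow> ('a, 'b) ptensor" where
  "sgn u = inverse (norm u) *\<^sub>R (u :: ('a, 'b) ptensor)"

definition dist_ptensor :: "('a, 'b) ptensor \<Rightarrow> ('a, 'b) ptensor \<Rightarrow> real" where
  "dist u v = norm (u - v :: ('a, 'b) ptensor)"

definition uniformity_ptensor :: "(('a, 'b) ptensor \<times> ('a, 'b) ptensor) filter" where
  "uniformity = (INF e\<in>{0 <..}. principal {(u, v :: ('a, 'b) ptensor). dist u v < e})"

definition open_ptensor :: "('a, 'b) ptensor set \<Rightarrow> bool" where
  "open (U :: ('a, 'b) ptensor set) \<longleftrightarrow>
     (\<forall>u\<in>U. \<forall>\<^sub>F (u', v) in uniformity. u' = u \<longrightarrow> v \<in> U)"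

instance
proof
  fix a b :: "('a, 'b) ptensor" and k :: complex and r :: real
  fix U :: "('a, 'b) ptensor set"
  show "dist a b = norm (a - b)" by (simp add: dist_ptensor_def)
  show "sgn a = a /\<^sub>R norm a" by (simp add: sgn_ptensor_def)
  show "uniformity = (INF e\<in>{0 <..}. principal {(u, v :: ('a, 'b) ptensor). dist u v < e})"
    by (simp add: uniformity_ptensor_def)
  show "open U \<longleftrightarrow> (\<forall>u\<in>U. \<forall>\<^sub>F (u', v) in uniformity. u' = u \<longrightarrow> v \<in> U)"
    by (simp add: open_ptensor_def)
  show "norm a = 0 \<longleftrightarrow> a = 0"
  proof transfer
    fix X :: "nat \<Rightarrow> ('a, 'b) atensor"
    assume "proj_equiv X X"
    then have X: "proj_Cauchy X" by (simp add: proj_equiv_def)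
    have "lim (\<lambda>n. proj_norm (X n)) = 0 \<longleftrightarrow> (\<lambda>n. proj_norm (X n)) \<longlonglongrightarrow> 0"
      using proj_Cauchy_norm_lim[OF X] limI by metis
    then show "lim (\<lambda>n. proj_norm (X n)) = 0 \<longleftrightarrow> proj_equiv X (\<lambda>_. 0)"
      using X by (simp add: proj_equiv_def)
  qed
  show "norm (a + b) \<le> norm a + norm b"
  proof transfer
    fix X Y :: "nat \<Rightarrow> ('a, 'b) atensor"
    assume "proj_equiv X X" "proj_equiv Y Y"
    then have X: "proj_Cauchy X" and Y: "proj_Cauchy Y" by (auto simp: proj_equiv_def)
    show "lim (\<lambda>n. proj_norm (X n + Y n)) \<le> lim (\<lambda>n. proj_norm (X n)) + lim (\<lambda>n. proj_norm (Y n))"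
      by (rule LIMSEQ_le[OF proj_Cauchy_norm_lim[OF proj_Cauchy_add[OF X Y]]
            tendsto_add[OF proj_Cauchy_norm_lim[OF X] proj_Cauchy_norm_lim[OF Y]]])
        (auto simp: proj_norm_triangle)
  qed
  show norm: "norm (k *\<^sub>C a) = cmod k * norm a" for k
  proof transfer
    fix k and X :: "nat \<Rightarrow> ('a, 'b) atensor"
    assume "proj_equiv X X"
    then have X: "proj_Cauchy X" by (auto simp: proj_equiv_def)
    show "lim (\<lambda>n. proj_norm (k *\<^sub>C X n)) = cmod k * lim (\<lambda>n. proj_norm (X n))"
      unfolding proj_norm_scaleC
      by (intro limI tendsto_mult_left proj_Cauchy_norm_lim X)
  qed
  show "norm (r *\<^sub>R a) = \<bar>r\<bar> * norm a" by (simp add: scaleR_scaleC norm)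
qed

end

lift_definition ptensor_of ::
  "('a::complex_normed_vector, 'b::complex_normed_vector) atensor \<Rightarrow> ('a, 'b) ptensor"
  is "\<lambda>z _. z"
  by (simp add: proj_equiv_def)

lemma ptensor_of_add: "ptensor_of (z + w) = ptensor_of z + ptensor_of w"
  by transfer (simp add: proj_equiv_def)

lemma ptensor_of_scaleC: "ptensor_of (c *\<^sub>C z) = c *\<^sub>C ptensor_of z"
  by transfer (simp add: proj_equiv_def)

lemma ptensor_of_zero: "ptensor_of 0 = 0"
  by transfer (simp add: proj_equiv_def)

lemma ptensor_of_diff: "ptensor_of (z - w) = ptensor_of z - ptensor_of w"
  using ptensor_of_add[of "z - w" w] by simp

lemma norm_ptensor_of: "norm (ptensor_of z) = proj_norm z"
  by transfer simp

lemma abs_ptensor_tendsto: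
  assumes "proj_Cauchy X"
  shows "(\<lambda>n. ptensor_of (X n)) \<longlonglongrightarrow> abs_ptensor X"
proof (rule LIMSEQ_I)
  fix e :: real assume "0 < e"
  then obtain N where N: "\<And>m n. m \<ge> N \<Longrightarrow> n \<ge> N \<Longrightarrow> proj_norm (X m - X n) < e / 2"
    using assms unfolding proj_Cauchy_def by (meson half_gt_zero)
  have "norm (ptensor_of (X n) - abs_ptensor X) < e" if n: "n \<ge> N" for n
  proof -
    have "ptensor_of (X n) - abs_ptensor X = ptensor_of (X n) + (- 1) *\<^sub>C abs_ptensor X" by simp
    also have "\<dots> = abs_ptensor (\<lambda>m. X n + (- 1) *\<^sub>C X m)"
      using assms by (simp only: ptensor_of_def map_fun_apply id_apply scaleC_ptensor.abs_eq plus_ptensor.abs_eq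
          proj_equiv_def proj_Cauchy_scaleC proj_Cauchy_const diff_self proj_norm_zero
          tendsto_const simp_thms)
    finally have eq:
      "ptensor_of (X n) - abs_ptensor X = abs_ptensor (\<lambda>m. X n + (- 1) *\<^sub>C X m)" .
    have cauchy: "proj_Cauchy (\<lambda>m. X n + (- 1) *\<^sub>C X m)"
      using assms by (intro proj_Cauchy_add proj_Cauchy_const proj_Cauchy_scaleC)
    have "norm (ptensor_of (X n) - abs_ptensor X) = lim (\<lambda>m. proj_norm (X n + (- 1) *\<^sub>C X m))"
      unfolding eq using cauchy by (intro norm_ptensor.abs_eq) (simp add: proj_equiv_def)
    also have "\<dots> \<le> e / 2"
    proof (rule LIMSEQ_le_const2[OF proj_Cauchy_norm_lim[OF cauchy]])
      show "\<exists>M. \<forall>m\<ge>M. proj_norm (X n + - 1 *\<^sub>C X m) \<le> e / 2"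
        using N[OF n] by (intro exI[of _ N]) (auto intro: less_imp_le)
    qed
    finally show ?thesis using \<open>0 < e\<close> by simp
  qed
  then show "\<exists>N. \<forall>n\<ge>N. norm (ptensor_of (X n) - abs_ptensor X) < e" by blast
qed

lemma ptensor_of_dense:
  obtains X where "proj_Cauchy X" "(\<lambda>n. ptensor_of (X n)) \<longlonglongrightarrow> u"
proof -
  obtain X where "proj_equiv X X" "u = abs_ptensor X"
    by (metis Quotient3_abs_rep Quotient3_ptensor Quotient3_rep_reflp)
  then show ?thesis using abs_ptensor_tendsto that by (auto simp: proj_equiv_def)
qed

lemma proj_Cauchy_iff: "proj_Cauchy X \<longleftrightarrow> Cauchy (\<lambda>n. ptensor_of (X n))"
  by (simp add: proj_Cauchy_def Cauchy_def dist_norm norm_ptensor_of flip: ptensor_of_diff)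

lemma Cauchy_diff_null:
  fixes u v :: "nat \<Rightarrow> 'a::real_normed_vector"
  assumes "Cauchy u" "(\<lambda>n. u n - v n) \<longlonglongrightarrow> 0"
  shows "Cauchy v"
proof (rule CauchyI)
  fix e :: real assume "0 < e"
  then obtain M N where
    M: "\<And>m n. m \<ge> M \<Longrightarrow> n \<ge> M \<Longrightarrow> norm (u m - u n) < e / 3" and
    N: "\<And>n. n \<ge> N \<Longrightarrow> norm (u n - v n) < e / 3"
    using CauchyD[OF assms(1), of "e / 3"] LIMSEQ_D[OF assms(2), of "e / 3"] by auto
  have "norm (v m - v n) < e" if "m \<ge> max M N" "n \<ge> max M N" for m n
  proof -
    have "v m - v n = (u m - u n) - (u m - v m) + (u n - v n)" by simp
    also have "norm \<dots> \<le> norm (u m - u n) + norm (u m - v m) + norm (u n - v n)"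
      by (meson add_right_mono norm_triangle_ineq norm_triangle_ineq4 order_trans)
    finally show ?thesis using M[of m n] N[of m] N[of n] that by simp
  qed
  then show "\<exists>K. \<forall>m\<ge>K. \<forall>n\<ge>K. norm (v m - v n) < e" by blast
qed

instance ptensor :: (complex_normed_vector, complex_normed_vector) complex_banach
proof
  fix u :: "nat \<Rightarrow> ('a, 'b) ptensor"
  assume u: "Cauchy u"
  have "\<exists>z. norm (u n - ptensor_of z) < 1 / Suc n" for n
  proof -
    obtain X where "(\<lambda>k. ptensor_of (X k)) \<longlonglongrightarrow> u n" using ptensor_of_dense .
    from LIMSEQ_D[OF this, of "1 / Suc n"] obtain k
      where "norm (ptensor_of (X k) - u n) < 1 / Suc n" by auto
    then show ?thesis by (metis norm_minus_commute)
  qed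
  then obtain z where z: "\<And>n. norm (u n - ptensor_of (z n)) < 1 / Suc n" by metis
  have diff: "(\<lambda>n. u n - ptensor_of (z n)) \<longlonglongrightarrow> 0"
    by (rule Lim_null_comparison[OF _ LIMSEQ_inverse_real_of_nat])
      (use z in \<open>auto intro!: always_eventually less_imp_le simp: inverse_eq_divide\<close>)
  have "Cauchy (\<lambda>n. ptensor_of (z n))" using u diff by (rule Cauchy_diff_null)
  then have "(\<lambda>n. ptensor_of (z n)) \<longlonglongrightarrow> abs_ptensor z"
    by (intro abs_ptensor_tendsto) (simp add: proj_Cauchy_iff)
  from tendsto_add[OF diff this] show "convergent u" by (auto intro: convergentI)
qed

definition ptensor ::
  "'a::complex_normed_vector \<Rightarrow> 'b::complex_normed_vector \<Rightarrow> ('a, 'b) ptensor"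
  (infixr \<open>\<otimes>\<^sub>\<pi>\<close> 70) where
  "x \<otimes>\<^sub>\<pi> y = ptensor_of (atensor x y)"

definition tensor_id ::
  "('a::complex_normed_vector \<Rightarrow> 'a) \<Rightarrow>
   ('a, 'b::complex_normed_vector) ptensor \<Rightarrow> ('a, 'b) ptensor" where
  "tensor_id T = (THE U. bounded_clinear U \<and> (\<forall>x y. U (x \<otimes>\<^sub>\<pi> y) = T x \<otimes>\<^sub>\<pi> y))"

lemma tensor_id_unique:
  fixes U V :: "('a::complex_normed_vector, 'b::complex_normed_vector) ptensor \<Rightarrow>
      'c::complex_normed_vector"
  assumes "bounded_clinear U" "bounded_clinear V" "\<And>x y. U (x \<otimes>\<^sub>\<pi> y) = V (x \<otimes>\<^sub>\<pi> y)"
  shows "U = V"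
proof
  fix u :: "('a, 'b) ptensor"
  interpret U: bounded_linear U by (rule bounded_clinear_imp_bounded_linear[OF assms(1)])
  interpret V: bounded_linear V by (rule bounded_clinear_imp_bounded_linear[OF assms(2)])
  have *: "U (ptensor_of z) = V (ptensor_of z)" for z
  proof -
    obtain ps where z: "z = (\<Sum>(x, y)\<leftarrow>ps. atensor x y)" using atensor_representation .
    show ?thesis unfolding z
      by (induction ps)
        (auto simp: ptensor_of_zero ptensor_of_add U.add V.add U.zero V.zero assms(3)
          simp flip: ptensor_def)
  qed
  obtain X where X: "(\<lambda>n. ptensor_of (X n)) \<longlonglongrightarrow> u" using ptensor_of_dense .
  from LIMSEQ_unique[OF U.tendsto[OF X]] V.tendsto[OF X] show "U u = V u" by (simp add: *)
qed

lemma tensor_id_exists: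
  fixes T :: "'a::complex_normed_vector \<Rightarrow> 'a"
  assumes "bounded_clinear T"
  shows "\<exists>U. bounded_clinear U \<and>
    (\<forall>x (y :: 'b::complex_normed_vector). U (x \<otimes>\<^sub>\<pi> y) = T x \<otimes>\<^sub>\<pi> y)"
proof -
  have T: "clinear T" using assms by (simp add: bounded_clinear_def)
  obtain K where K: "\<And>x. norm (T x) \<le> norm x * K" "0 \<le> K"
    using bounded_linear.nonneg_bounded[OF bounded_clinear_imp_bounded_linear[OF assms]] by blast
  define f :: "('a, 'b) atensor \<Rightarrow> ('a, 'b) atensor" where
    "f z = abs_atensor (map (\<lambda>(x, y). (T x, y)) (rep_atensor z))" for z
  have f_abs: "f (abs_atensor ps) = abs_atensor (map (\<lambda>(x, y). (T x, y)) ps)" for ps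
  proof -
    have "tensor_eq (rep_atensor (abs_atensor ps)) ps"
      using Quotient3_abs_rep[OF Quotient3_atensor] by (metis atensor.abs_eq_iff)
    moreover have "cbilinear (\<lambda>x. B (T x))" if "cbilinear B"
      for B :: "'a \<Rightarrow> 'b \<Rightarrow> complex"
      using that T by (simp add: cbilinear_iff clinear_iff)
    ultimately have "tensor_eq (map (\<lambda>(x, y). (T x, y)) (rep_atensor (abs_atensor ps)))
        (map (\<lambda>(x, y). (T x, y)) ps)"
      by (simp add: tensor_eq_def formal_sum_map_fst)
    then show ?thesis by (simp add: f_def atensor.abs_eq_iff)
  qed
  have f_sum: "f (\<Sum>(x, y)\<leftarrow>ps. atensor x y) = (\<Sum>(x, y)\<leftarrow>ps. atensor (T x) y)" for ps
    using f_abs[of ps] by (simp add: abs_atensor_eq_sum case_prod_unfold comp_def)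
  have f_add: "f (z + w) = f z + f w" for z w
  proof -
    obtain ps qs where "z = (\<Sum>(x, y)\<leftarrow>ps. atensor x y)" "w = (\<Sum>(x, y)\<leftarrow>qs. atensor x y)"
      by (metis atensor_representation)
    then show ?thesis using f_sum[of ps] f_sum[of qs] f_sum[of "ps @ qs"] by simp
  qed
  have f_scale: "f (c *\<^sub>C z) = c *\<^sub>C f z" for c z
  proof -
    obtain ps where z: "z = abs_atensor ps" using atensor_representation abs_atensor_eq_sum by metis
    have "map (\<lambda>(x, y). (T x, y)) (map (\<lambda>(x, y). (c *\<^sub>C x, y)) ps) =
        map (\<lambda>(x, y). (c *\<^sub>C x, y)) (map (\<lambda>(x, y). (T x, y)) ps)"
      using T by (auto simp: clinear_iff)
    then show ?thesis by (simp only: z scaleC_atensor.abs_eq f_abs)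
  qed
  have f_diff: "f (z - w) = f z - f w" for z w using f_add[of "z - w" w] by simp
  have f_bound: "proj_norm (f z) \<le> K * proj_norm z" for z
    by (rule proj_norm_map_fst_le[OF K f_sum])
  have ex: "\<exists>v. \<forall>X. (\<lambda>n. ptensor_of (X n)) \<longlonglongrightarrow> u \<longrightarrow> (\<lambda>n. ptensor_of (f (X n))) \<longlonglongrightarrow> v" for u
  proof -
    obtain X where X: "proj_Cauchy X" "(\<lambda>n. ptensor_of (X n)) \<longlonglongrightarrow> u" using ptensor_of_dense .
    have "proj_Cauchy (\<lambda>n. f (X n))"
      by (rule proj_Cauchy_bound[OF X(1), of _ K]) (simp add: f_bound flip: f_diff)
    then obtain v where v: "(\<lambda>n. ptensor_of (f (X n))) \<longlonglongrightarrow> v" using abs_ptensor_tendsto by blast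
    have "(\<lambda>n. ptensor_of (f (Y n))) \<longlonglongrightarrow> v" if Y: "(\<lambda>n. ptensor_of (Y n)) \<longlonglongrightarrow> u" for Y
    proof -
      have "(\<lambda>n. K * norm (ptensor_of (Y n) - ptensor_of (X n))) \<longlonglongrightarrow> 0"
        using tendsto_diff[OF Y X(2)] by (intro tendsto_mult_right_zero tendsto_norm_zero) simp
      then have "(\<lambda>n. ptensor_of (f (Y n)) - ptensor_of (f (X n))) \<longlonglongrightarrow> 0"
        by (rule Lim_null_comparison[rotated])
          (simp add: norm_ptensor_of f_bound flip: ptensor_of_diff f_diff)
      from tendsto_add[OF this v] show ?thesis by simp
    qed
    then show ?thesis by blast
  qed
  then obtain U where U: "\<And>u X. (\<lambda>n. ptensor_of (X n)) \<longlonglongrightarrow> u \<Longrightarrow>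
      (\<lambda>n. ptensor_of (f (X n))) \<longlonglongrightarrow> U u"
    by metis
  have U_of: "U (ptensor_of z) = ptensor_of (f z)" for z
    using U[of "\<lambda>_. z" "ptensor_of z"] by (simp add: tendsto_const_iff)
  have "U (u + v) = U u + U v" for u v
  proof -
    obtain X Y where X: "(\<lambda>n. ptensor_of (X n)) \<longlonglongrightarrow> u" and Y: "(\<lambda>n. ptensor_of (Y n)) \<longlonglongrightarrow> v"
      by (metis ptensor_of_dense)
    have "(\<lambda>n. ptensor_of (f (X n + Y n))) \<longlonglongrightarrow> U (u + v)"
      by (rule U) (simp add: ptensor_of_add tendsto_add X Y)
    moreover have "(\<lambda>n. ptensor_of (f (X n + Y n))) \<longlonglongrightarrow> U u + U v"
      by (simp add: f_add ptensor_of_add tendsto_add U X Y)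
    ultimately show ?thesis by (rule LIMSEQ_unique)
  qed
  moreover have "U (c *\<^sub>C u) = c *\<^sub>C U u" for c u
  proof -
    obtain X where X: "(\<lambda>n. ptensor_of (X n)) \<longlonglongrightarrow> u" by (metis ptensor_of_dense)
    have sc: "(\<lambda>n. c *\<^sub>C w n) \<longlonglongrightarrow> c *\<^sub>C v" if "w \<longlonglongrightarrow> v" for w and v :: "('a, 'b) ptensor"
    proof -
      have "bounded_linear (\<lambda>v :: ('a, 'b) ptensor. c *\<^sub>C v)"
        by (rule bounded_linear_intro[where K = "cmod c"])
          (simp_all add: scaleC_add_right norm_scaleC scaleR_scaleC scaleC_scaleC mult.commute)
      then show ?thesis using that by (rule bounded_linear.tendsto)
    qed
    have "(\<lambda>n. ptensor_of (f (c *\<^sub>C X n))) \<longlonglongrightarrow> U (c *\<^sub>C u)"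
      by (rule U) (simp add: ptensor_of_scaleC sc X)
    moreover have "(\<lambda>n. ptensor_of (f (c *\<^sub>C X n))) \<longlonglongrightarrow> c *\<^sub>C U u"
      by (simp add: ptensor_of_scaleC f_scale sc U X)
    ultimately show ?thesis by (rule LIMSEQ_unique)
  qed
  moreover have "norm (U u) \<le> norm u * K" for u
  proof -
    obtain X where X: "(\<lambda>n. ptensor_of (X n)) \<longlonglongrightarrow> u" by (metis ptensor_of_dense)
    show ?thesis
      by (rule LIMSEQ_le[OF tendsto_norm[OF U[OF X]] tendsto_mult_right[OF tendsto_norm[OF X]]])
        (use f_bound in \<open>simp add: norm_ptensor_of mult.commute\<close>)
  qed
  moreover have "U (x \<otimes>\<^sub>\<pi> y) = T x \<otimes>\<^sub>\<pi> y" for x y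
    using f_sum[of "[(x, y)]"] by (simp add: ptensor_def U_of)
  ultimately have "bounded_clinear U \<and> (\<forall>x y. U (x \<otimes>\<^sub>\<pi> y) = T x \<otimes>\<^sub>\<pi> y)"
    unfolding bounded_clinear_def clinear_iff by blast
  then show ?thesis by blast
qed

lemma
  fixes T :: "'a::complex_normed_vector \<Rightarrow> 'a" and y :: "'b::complex_normed_vector"
  assumes "bounded_clinear T"
  shows bounded_clinear_tensor_id:
      "bounded_clinear (tensor_id T :: ('a, 'b) ptensor \<Rightarrow> ('a, 'b) ptensor)"
    and tensor_id_ptensor: "tensor_id T (x \<otimes>\<^sub>\<pi> y) = T x \<otimes>\<^sub>\<pi> y"
proof -
  have "\<exists>!U. bounded_clinear U \<and> (\<forall>x (y :: 'b). U (x \<otimes>\<^sub>\<pi> y) = T x \<otimes>\<^sub>\<pi> y)"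
    using tensor_id_exists[OF assms] by (rule ex_ex1I) (auto intro: tensor_id_unique)
  from theI'[OF this] show "bounded_clinear (tensor_id T :: ('a, 'b) ptensor \<Rightarrow> ('a, 'b) ptensor)"
    "tensor_id T (x \<otimes>\<^sub>\<pi> y) = T x \<otimes>\<^sub>\<pi> y"
    by (simp_all add: tensor_id_def)
qed

end

theory Submission
  imports Defs
begin

text \<open>
  The three conditions are linked by the cycle (i) $\Rightarrow$ (ii) $\Rightarrow$ (iii)
  $\Rightarrow$ (i).

  From (i) to (ii).  The criterion is inherited by $T \otimes I$, because it only asks for the
  convergence of finitely many quantities at a time: take finite sums of tensors $x \otimes y$ with
  $x$ in the dense set of $T$ and $y$ arbitrary, and let the approximate right inverses act on the
  left factors (\<open>criterion_tensor_id\<close>).  On a separable Banach space the criterion implies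
  supercyclicity.  A smallness condition on the product $\|T^n x\| \|S y\|$ allows one to rescale
  so that both $x + c S y$ is close to $x$ and $c^{-1} T^n (x + c S y)$ is close to $y$; hence
  scaled powers of $T$ move any ball into any other, and Baire's theorem provides one vector whose
  projective orbit meets all balls (\<open>supercyclic_if_criterion\<close>).

  From (ii) to (iii).  Since $\dim F \geq 2$, there are continuous functionals $\phi$ and $\psi$ on
  $F$ for which $y \mapsto (\phi(y), \psi(y))$ is onto $\mathbb{C}^2$.  Their existence is a form of
  the Hahn--Banach theorem.  The map $x \otimes y \mapsto (\phi(y) x, \psi(y) x)$ then extends to a
  bounded surjection of $E \widehat{\otimes}_\pi F$ onto $E \oplus E$, by the universal property
  \<open>ptensor_lift\<close>, and it carries $T \otimes I$ to $T \oplus T$.  Supercyclic vectors are mapped to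
  supercyclic vectors.

  From (iii) to (i).  If $(x, y)$ is supercyclic for $T \oplus T$, there are scalars $\alpha_k$ and
  exponents $n_k$ with $\alpha_k T^{n_k} x \to 0$ and $\alpha_k T^{n_k} y \to x$.  Then
  $u_k = \alpha_k y$ satisfies $T^{n_k} u_k \to x$ and $\|T^{n_k} x\| \|u_k\| \to 0$.  Both dense sets
  of the criterion are the projective orbit of $x$, and the approximate right inverse sends
  $c T^m x$ to $c T^m u_k$.
\<close>

section \<open>Continuous functionals that separate points\<close>

text \<open>
  Homogeneity is required only as an inequality, which is what survives when infima are taken;
  applying it to $t$ and to $1 / t$ gives the equality (\<open>sublinear_scale\<close>).
\<close>

definition sublinear :: "('a::real_vector \<Rightarrow> real) \<Rightarrow> bool" where
  "sublinear p \<longleftrightarrow>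
     (\<forall>x y. p (x + y) \<le> p x + p y) \<and> (\<forall>t>0. \<forall>x. p (t *\<^sub>R x) \<le> t * p x)"

lemma sublinear_add: "sublinear p \<Longrightarrow> p (x + y) \<le> p x + p y"
  by (simp add: sublinear_def)

lemma sublinear_zero:
  assumes "sublinear p"
  shows "p 0 = 0"
proof -
  have scale: "p (t *\<^sub>R 0) \<le> t * p 0" if "0 < t" for t
    using assms that by (simp only: sublinear_def)
  show ?thesis using scale[of "1/2"] scale[of 2] by simp
qed

lemma sublinear_scale:
  assumes "sublinear p" "0 \<le> t"
  shows "p (t *\<^sub>R x) = t * p x"
proof (cases "t = 0")
  case False
  with assms have t: "0 < t" by simp
  have "p (t *\<^sub>R x) \<le> t * p x" using assms(1) t by (simp add: sublinear_def)
  moreover have "p ((1/t) *\<^sub>R (t *\<^sub>R x)) \<le> (1/t) * p (t *\<^sub>R x)"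
    using assms(1) t by (simp only: sublinear_def zero_less_divide_1_iff)
  then have "t * p x \<le> p (t *\<^sub>R x)" using t by (simp add: field_simps)
  ultimately show ?thesis by simp
qed (simp add: sublinear_zero[OF assms(1)])

lemma sublinear_minus_ge: "sublinear p \<Longrightarrow> - p (- x) \<le> p x"
  using sublinear_add[of p x "- x"] sublinear_zero[of p] by simp

lemma sublinear_norm: "sublinear (norm :: 'a::real_normed_vector \<Rightarrow> real)"
  by (simp add: sublinear_def norm_triangle_ineq)

text \<open>
  A witness is $r(x) = \inf_{t \geq 0} \bigl(q(x + t v) - t q(v)\bigr)$; the two bounds are the
  terms $t = 0$ and $t = 1$.  Unless $q$ is already additive in the direction $v$, this is a strictly
  smaller functional, and at $x = - v$ it is as small as possible, $r(- v) \leq - q(v)$.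
\<close>

lemma sublinear_decrease:
  assumes q: "sublinear q"
  obtains r where "sublinear r" "\<And>x. r x \<le> q x" "\<And>x. r x \<le> q (x + v) - q v"
proof -
  define h where "h x t = q (x + t *\<^sub>R v) - t * q v" for x t
  define r where "r x = (INF t\<in>{0..}. h x t)" for x
  have bdd: "bdd_below (h x ` {0..})" for x
  proof (rule bdd_belowI2)
    fix t :: real assume "t \<in> {0..}"
    then have "t * q v = q (t *\<^sub>R v)" using sublinear_scale[OF q] by simp
    also have "\<dots> \<le> q (x + t *\<^sub>R v) + q (- x)"
      using sublinear_add[OF q, of "x + t *\<^sub>R v" "- x"] by simp
    finally show "- q (- x) \<le> h x t" by (simp add: h_def)
  qed
  have le: "r x \<le> h x t" if "0 \<le> t" for x t
    unfolding r_def using bdd that by (intro cINF_lower) auto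
  have ge: "c \<le> r x" if "\<And>t. 0 \<le> t \<Longrightarrow> c \<le> h x t" for c x
    unfolding r_def using that by (intro cINF_greatest) auto
  have add: "r (x + y) \<le> r x + r y" for x y
  proof -
    have "r (x + y) - h x s \<le> r y" if s: "0 \<le> s" for s
    proof (rule ge)
      fix t :: real assume t: "0 \<le> t"
      have "r (x + y) \<le> h (x + y) (s + t)" using s t by (intro le) simp
      also have "\<dots> \<le> h x s + h y t"
        using sublinear_add[OF q, of "x + s *\<^sub>R v" "y + t *\<^sub>R v"]
        by (simp add: h_def algebra_simps)
      finally show "r (x + y) - h x s \<le> h y t" by simp
    qed
    then have "r (x + y) - r y \<le> r x" by (intro ge) (simp add: algebra_simps)
    then show ?thesis by simp
  qed
  have scale: "r (c *\<^sub>R x) \<le> c * r x" if c: "0 < c" for c x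
  proof -
    have "r (c *\<^sub>R x) / c \<le> r x"
    proof (rule ge)
      fix t :: real assume t: "0 \<le> t"
      have "r (c *\<^sub>R x) \<le> h (c *\<^sub>R x) (c * t)" using c t by (intro le) simp
      also have "\<dots> = c * h x t"
        using sublinear_scale[OF q, of c "x + t *\<^sub>R v"] c by (simp add: h_def algebra_simps)
      finally show "r (c *\<^sub>R x) / c \<le> h x t" using c by (simp add: field_simps)
    qed
    then show ?thesis using c by (simp add: field_simps)
  qed
  show thesis
  proof (rule that)
    show "sublinear r" using add scale by (simp add: sublinear_def)
    show "r x \<le> q x" for x using le[of 0 x] by (simp add: h_def)
    show "r x \<le> q (x + v) - q v" for x using le[of 1 x] by (simp add: h_def)
  qed
qed

text \<open>
  Zorn's lemma, for the reverse pointwise order: the infimum of a chain of sublinear functionals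
  below $p$ is finite because each of them is at least $- p(- x)$ at $x$, and it is subadditive because
  of any two members of the chain one lies below both.
\<close>

lemma minimal_sublinear:
  assumes p: "sublinear p"
  obtains q where "sublinear q" "\<And>x. q x \<le> p x"
    "\<And>r. sublinear r \<Longrightarrow> (\<And>x. r x \<le> q x) \<Longrightarrow> r = q"
proof -
  define A where "A = {q. sublinear q \<and> (\<forall>x. q x \<le> p x)}"
  define P where "P q r \<longleftrightarrow> (\<forall>x. r x \<le> q x)" for q r :: "'a \<Rightarrow> real"
  have "\<exists>m\<in>A. \<forall>a\<in>A. P m a \<longrightarrow> a = m"
  proof (rule predicate_Zorn)
    show "partial_order_on A (relation_of P A)"
      by (rule partial_order_on_relation_ofI) (auto simp: P_def fun_eq_iff intro: order_trans antisym)
    fix C assume C: "C \<in> Chains (relation_of P A)"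
    then have CA: "\<And>q. q \<in> C \<Longrightarrow> q \<in> A"
      and total: "\<And>q r. q \<in> C \<Longrightarrow> r \<in> C \<Longrightarrow> P q r \<or> P r q"
      by (auto simp: Chains_def relation_of_def)
    show "\<exists>u\<in>A. \<forall>a\<in>C. P a u"
    proof (cases "C = {}")
      case True
      then show ?thesis using p by (auto simp: A_def)
    next
      case False
      define u where "u x = (INF q\<in>C. q x)" for x
      have bdd: "bdd_below ((\<lambda>q. q x) ` C)" for x
      proof (rule bdd_belowI2)
        fix q assume "q \<in> C"
        then have "sublinear q" "q (- x) \<le> p (- x)" using CA by (auto simp: A_def)
        with sublinear_minus_ge[of q x] show "- p (- x) \<le> q x" by simp
      qed
      have le: "u x \<le> q x" if "q \<in> C" for q x
        unfolding u_def using bdd that by (intro cINF_lower) auto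
      have ge: "c \<le> u x" if "\<And>q. q \<in> C \<Longrightarrow> c \<le> q x" for c x
        unfolding u_def using that False by (intro cINF_greatest) auto
      have mixed: "u (x + y) \<le> q x + r y" if qr: "q \<in> C" "r \<in> C" for q r x y
      proof -
        obtain s where s: "s \<in> C" "P q s" "P r s" using total[OF qr] qr by (auto simp: P_def)
        have "u (x + y) \<le> s x + s y"
          using le[OF s(1), of "x + y"] CA[OF s(1)] sublinear_add[of s x y] by (simp add: A_def)
        also have "\<dots> \<le> q x + r y" using s by (intro add_mono) (auto simp: P_def)
        finally show ?thesis .
      qed
      have "u (x + y) \<le> u x + u y" for x y
      proof -
        have "u (x + y) - q x \<le> u y" if "q \<in> C" for q
          using mixed[OF that] by (intro ge) (simp add: algebra_simps)
        then have "u (x + y) - u y \<le> u x" by (intro ge) (simp add: algebra_simps)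
        then show ?thesis by simp
      qed
      moreover have "u (t *\<^sub>R x) \<le> t * u x" if t: "0 < t" for t x
      proof -
        have "u (t *\<^sub>R x) / t \<le> u x"
        proof (rule ge)
          fix q assume q: "q \<in> C"
          have "u (t *\<^sub>R x) \<le> t * q x"
            using le[OF q, of "t *\<^sub>R x"] CA[OF q] sublinear_scale[of q t x] t by (simp add: A_def)
          then show "u (t *\<^sub>R x) / t \<le> q x" using t by (simp add: field_simps)
        qed
        then show ?thesis using t by (simp add: field_simps)
      qed
      moreover obtain q where "q \<in> C" using False by blast
      then have "u x \<le> p x" for x
        using le[of q x] CA[of q] by (auto simp: A_def intro: order_trans)
      ultimately have "u \<in> A" by (simp add: A_def sublinear_def)
      then show ?thesis using le by (auto simp: P_def)
    qed
  qed
  then obtain q where q: "q \<in> A" "\<And>a. a \<in> A \<Longrightarrow> P q a \<Longrightarrow> a = q" by blast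
  show thesis
  proof (rule that)
    show "sublinear q" "\<And>x. q x \<le> p x" using q(1) by (auto simp: A_def)
    show "r = q" if "sublinear r" "\<And>x. r x \<le> q x" for r
      using q that unfolding A_def P_def by (blast intro: order_trans)
  qed
qed

text \<open>
  A minimal sublinear functional cannot be decreased in any direction $v$, so it is
  superadditive as well as subadditive.
\<close>

lemma minimal_sublinear_linear:
  assumes q: "sublinear q"
    and minimal: "\<And>r. sublinear r \<Longrightarrow> (\<And>x. r x \<le> q x) \<Longrightarrow> r = q"
  shows "linear q"
proof -
  have add: "q (x + v) = q x + q v" for x v
  proof -
    obtain r where r: "sublinear r" "\<And>x. r x \<le> q x" "\<And>x. r x \<le> q (x + v) - q v"
      using sublinear_decrease[OF q] by blast
    have "r = q" by (rule minimal[OF r(1,2)])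
    with r(3)[of x] sublinear_add[OF q, of x v] show ?thesis by simp
  qed
  have neg: "q (- x) = - q x" for x using add[of x "- x"] sublinear_zero[OF q] by simp
  have "q (c *\<^sub>R x) = c * q x" for c x
  proof (cases "0 \<le> c")
    case False
    then have "q ((- c) *\<^sub>R x) = (- c) * q x" by (intro sublinear_scale[OF q]) simp
    then show ?thesis using neg[of "c *\<^sub>R x"] by simp
  qed (simp add: sublinear_scale[OF q])
  with add show ?thesis by (intro linearI) auto
qed

text \<open>
  Decreasing the norm in the direction $v$ first forces $g(- v) \leq - \|v\|$ for every $g$ below
  the result, and a minimal such $g$ is linear.
\<close>

theorem Hahn_Banach_norming:
  fixes v :: "'a::real_normed_vector"
  obtains g where "linear g" "\<And>x. \<bar>g x\<bar> \<le> norm x" "g v = norm v"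
proof -
  obtain p where p: "sublinear p" "\<And>x. p x \<le> norm x" "\<And>x. p x \<le> norm (x + v) - norm v"
    using sublinear_decrease[OF sublinear_norm] by blast
  obtain g where g: "sublinear g" "\<And>x. g x \<le> p x"
    "\<And>r. sublinear r \<Longrightarrow> (\<And>x. r x \<le> g x) \<Longrightarrow> r = g"
    using minimal_sublinear[OF p(1)] by blast
  have lin: "linear g" using g(1,3) by (rule minimal_sublinear_linear)
  have le: "g x \<le> norm x" for x using g(2) p(2) by (rule order_trans)
  have "g (- v) \<le> - norm v" using g(2)[of "- v"] p(3)[of "- v"] by simp
  then have "norm v \<le> g v" by (simp add: linear_neg[OF lin])
  then have "g v = norm v" using le[of v] by simp
  moreover have "\<bar>g x\<bar> \<le> norm x" for x
    using le[of x] le[of "- x"] by (simp add: linear_neg[OF lin] abs_le_iff)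
  ultimately show thesis using lin that by blast
qed

text \<open>
  The complex functional is recovered from its real part $g$ as $x \mapsto g(x) - i g(i x)$.
\<close>

lemma bounded_clinear_functional_exists:
  fixes v :: "'a::complex_normed_vector"
  assumes "v \<noteq> 0"
  obtains l :: "'a \<Rightarrow> complex" where "bounded_clinear l" "l v \<noteq> 0"
proof -
  obtain g where g: "linear g" "\<And>x. \<bar>g x\<bar> \<le> norm x" "g v = norm v"
    using Hahn_Banach_norming[of v] by blast
  define l where "l x = Complex (g x) (- g (\<i> *\<^sub>C x))" for x
  have scale: "g (c *\<^sub>C x) = Re c * g x + Im c * g (\<i> *\<^sub>C x)" for c x
  proof -
    have "c = complex_of_real (Re c) + complex_of_real (Im c) * \<i>" by (simp add: complex_eq_iff)
    then have "c *\<^sub>C x = Re c *\<^sub>R x + Im c *\<^sub>R (\<i> *\<^sub>C x)"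
      by (metis scaleC_add_left scaleR_scaleC scaleC_scaleC)
    then show ?thesis by (simp add: linear_add[OF g(1)] linear_scale[OF g(1)])
  qed
  have "l (c *\<^sub>C x) = c *\<^sub>C l x" for c x
    using scale[of c x] scale[of "\<i> * c" x]
    by (simp add: l_def scaleC_complex_def complex_eq_iff scaleC_scaleC algebra_simps)
  moreover have "l (x + y) = l x + l y" for x y
    by (simp add: l_def complex_eq_iff scaleC_add_right linear_add[OF g(1)])
  moreover have "norm (l x) \<le> norm x * 2" for x
    using cmod_le[of "l x"] g(2)[of x] g(2)[of "\<i> *\<^sub>C x"] by (simp add: l_def norm_scaleC)
  ultimately have "bounded_clinear l" unfolding bounded_clinear_def clinear_iff by blast
  moreover have "l v \<noteq> 0" using g(3) assms by (simp add: l_def complex_eq_iff)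
  ultimately show thesis by (rule that)
qed

section \<open>The projective tensor product\<close>

lemma bounded_linear_scaleC: "bounded_linear (\<lambda>v :: 'a::complex_normed_vector. c *\<^sub>C v)"
  by (rule bounded_linear_intro[where K = "cmod c"])
    (simp_all add: scaleC_add_right norm_scaleC scaleR_scaleC scaleC_scaleC mult.commute)

lemma bounded_bilinear_ptensor:
  "bounded_bilinear (ptensor :: 'a::complex_normed_vector \<Rightarrow> 'b::complex_normed_vector \<Rightarrow> _)"
proof
  note bilin = cbilinear_atensor[where ?'a = 'a and ?'b = 'b, unfolded cbilinear_iff]
  fix a a' :: 'a and b b' :: 'b and r :: real
  show "(a + a') \<otimes>\<^sub>\<pi> b = a \<otimes>\<^sub>\<pi> b + a' \<otimes>\<^sub>\<pi> b" "a \<otimes>\<^sub>\<pi> (b + b') = a \<otimes>\<^sub>\<pi> b + a \<otimes>\<^sub>\<pi> b'"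
    "(r *\<^sub>R a) \<otimes>\<^sub>\<pi> b = r *\<^sub>R (a \<otimes>\<^sub>\<pi> b)" "a \<otimes>\<^sub>\<pi> (r *\<^sub>R b) = r *\<^sub>R (a \<otimes>\<^sub>\<pi> b)"
    using bilin by (simp_all add: ptensor_def scaleR_scaleC flip: ptensor_of_add ptensor_of_scaleC)
  show "\<exists>K. \<forall>a b. norm ((a :: 'a) \<otimes>\<^sub>\<pi> (b :: 'b)) \<le> norm a * norm b * K"
    by (intro exI[of _ 1]) (simp add: ptensor_def norm_ptensor_of proj_norm_atensor_le)
qed

lemma norm_ptensor_le: "norm (x \<otimes>\<^sub>\<pi> y) \<le> norm x * norm y"
  by (simp add: ptensor_def norm_ptensor_of proj_norm_atensor_le)

lemma ptensor_of_sum: "ptensor_of (\<Sum>(x, y)\<leftarrow>ps. atensor x y) = (\<Sum>(x, y)\<leftarrow>ps. x \<otimes>\<^sub>\<pi> y)"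
  by (induction ps) (auto simp: ptensor_of_zero ptensor_of_add ptensor_def)

definition tensor_sums ::
  "'a::complex_normed_vector set \<Rightarrow> 'b::complex_normed_vector set \<Rightarrow> ('a, 'b) ptensor set" where
  "tensor_sums A B = {\<Sum>(x, y)\<leftarrow>ps. x \<otimes>\<^sub>\<pi> y | ps. set ps \<subseteq> A \<times> B}"

text \<open>
  The closure is stable under addition and, since $\otimes$ is jointly continuous, contains all
  elementary tensors; so it contains the algebraic tensor product, which is dense.
\<close>

lemma closure_tensor_sums:
  fixes A :: "'a::complex_normed_vector set" and B :: "'b::complex_normed_vector set"
  assumes "closure A = UNIV" "closure B = UNIV"
  shows "closure (tensor_sums A B) = UNIV"
proof -
  interpret bounded_bilinear "ptensor :: 'a \<Rightarrow> 'b \<Rightarrow> _" by (rule bounded_bilinear_ptensor)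
  let ?C = "closure (tensor_sums A B)"
  have zero: "0 \<in> ?C"
    by (intro subsetD[OF closure_subset]) (auto simp: tensor_sums_def intro!: exI[of _ "[]"])
  have add_sums: "u + v \<in> tensor_sums A B" if uv: "u \<in> tensor_sums A B" "v \<in> tensor_sums A B" for u v
  proof -
    obtain ps qs where "u = (\<Sum>(x, y)\<leftarrow>ps. x \<otimes>\<^sub>\<pi> y)" "v = (\<Sum>(x, y)\<leftarrow>qs. x \<otimes>\<^sub>\<pi> y)"
      "set ps \<subseteq> A \<times> B" "set qs \<subseteq> A \<times> B"
      using uv unfolding tensor_sums_def by blast
    then show ?thesis unfolding tensor_sums_def by (intro CollectI exI[of _ "ps @ qs"]) auto
  qed
  have add: "u + v \<in> ?C" if "u \<in> ?C" "v \<in> ?C" for u v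
  proof -
    obtain f g where "\<And>n. f n \<in> tensor_sums A B" "f \<longlonglongrightarrow> u" "\<And>n. g n \<in> tensor_sums A B" "g \<longlonglongrightarrow> v"
      using \<open>u \<in> ?C\<close> \<open>v \<in> ?C\<close> unfolding closure_sequential by metis
    then show ?thesis unfolding closure_sequential
      by (intro exI[of _ "\<lambda>n. f n + g n"]) (auto intro: tendsto_add add_sums)
  qed
  have elem: "x \<otimes>\<^sub>\<pi> y \<in> ?C" for x y
  proof -
    obtain f g where fg: "\<And>n. f n \<in> A" "f \<longlonglongrightarrow> x" "\<And>n. g n \<in> B" "g \<longlonglongrightarrow> y"
      using assms UNIV_I unfolding closure_sequential set_eq_iff by metis
    have "f n \<otimes>\<^sub>\<pi> g n \<in> tensor_sums A B" for n
      unfolding tensor_sums_def using fg by (intro CollectI exI[of _ "[(f n, g n)]"]) auto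
    then show ?thesis unfolding closure_sequential
      by (intro exI[of _ "\<lambda>n. f n \<otimes>\<^sub>\<pi> g n"]) (auto intro: tendsto fg)
  qed
  have "ptensor_of z \<in> ?C" for z
  proof -
    obtain ps where z: "z = (\<Sum>(x, y)\<leftarrow>ps. atensor x y)" using atensor_representation .
    have "(\<Sum>(x, y)\<leftarrow>ps. x \<otimes>\<^sub>\<pi> y) \<in> ?C" by (induction ps) (auto intro: zero add elem)
    then show ?thesis by (simp add: z ptensor_of_sum)
  qed
  then have "u \<in> closure ?C" for u
    unfolding closure_sequential[of _ ?C] by (metis ptensor_of_dense)
  then show ?thesis by auto
qed

lemma separable_ptensor:
  assumes "separable_space (euclidean :: 'a::complex_normed_vector topology)"
    and "separable_space (euclidean :: 'b::complex_normed_vector topology)"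
  shows "separable_space (euclidean :: ('a, 'b) ptensor topology)"
proof -
  obtain A :: "'a set" and B :: "'b set" where AB: "countable A" "closure A = UNIV"
    "countable B" "closure B = UNIV"
    using assms by (auto simp: separable_space_def)
  have "tensor_sums A B = (\<lambda>ps. \<Sum>(x, y)\<leftarrow>ps. x \<otimes>\<^sub>\<pi> y) ` lists (A \<times> B)"
    by (auto simp: tensor_sums_def lists_eq_set)
  then have "countable (tensor_sums A B)" using AB by simp
  with closure_tensor_sums[OF AB(2,4)] show ?thesis
    by (auto simp: separable_space_def)
qed

text \<open>
  Equality of tensors is tested by scalar bilinear forms only.  It carries over to bilinear maps
  into a normed space because the continuous functionals on that space separate points.
\<close>

lemma sum_list_eq_of_tensor_eq:
  fixes B :: "'a::complex_vector \<Rightarrow> 'b::complex_vector \<Rightarrow> 'c::complex_normed_vector"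
  assumes B: "cbilinear B" and eq: "tensor_eq ps qs"
  shows "(\<Sum>(x, y)\<leftarrow>ps. B x y) = (\<Sum>(x, y)\<leftarrow>qs. B x y)" (is "?s ps = ?s qs")
proof (rule ccontr)
  assume "?s ps \<noteq> ?s qs"
  then have "?s ps - ?s qs \<noteq> 0" by simp
  then obtain l :: "'c \<Rightarrow> complex" where l: "bounded_clinear l" "l (?s ps - ?s qs) \<noteq> 0"
    by (rule bounded_clinear_functional_exists)
  interpret bounded_linear l using l(1) by (rule bounded_clinear_imp_bounded_linear)
  have "cbilinear (\<lambda>x y. l (B x y))"
    using B l(1) by (simp add: cbilinear_iff bounded_clinear_def clinear_iff)
  then have "formal_sum (\<lambda>x y. l (B x y)) ps = formal_sum (\<lambda>x y. l (B x y)) qs"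
    using eq by (simp add: tensor_eq_def)
  moreover have "formal_sum (\<lambda>x y. l (B x y)) rs = l (?s rs)" for rs
    by (induction rs) (auto simp: add zero)
  ultimately show False using l(2) by (simp add: diff)
qed

text \<open>
  The universal property of the completed projective tensor product: the sum
  $\sum_j B(x_j, y_j)$ depends only on the tensor $\sum_j x_j \otimes y_j$, is bounded by $K$ times
  its projective norm, and therefore extends to the completion by continuity.
\<close>

theorem ptensor_lift:
  fixes B :: "'a::complex_normed_vector \<Rightarrow> 'b::complex_normed_vector \<Rightarrow> 'c::complex_banach"
  assumes B: "cbilinear B" and K: "\<And>x y. norm (B x y) \<le> K * (norm x * norm y)" "0 \<le> K"
  obtains L where "bounded_clinear L" "\<And>x y. L (x \<otimes>\<^sub>\<pi> y) = B x y"
proof -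
  define m where "m z = (\<Sum>(x, y)\<leftarrow>rep_atensor z. B x y)" for z
  have m_sum: "m (\<Sum>(x, y)\<leftarrow>ps. atensor x y) = (\<Sum>(x, y)\<leftarrow>ps. B x y)" for ps
  proof -
    have "tensor_eq (rep_atensor (abs_atensor ps)) ps"
      using Quotient3_abs_rep[OF Quotient3_atensor] by (metis atensor.abs_eq_iff)
    from sum_list_eq_of_tensor_eq[OF B this] show ?thesis by (simp add: m_def abs_atensor_eq_sum)
  qed
  have m_add: "m (z + w) = m z + m w" for z w
  proof -
    obtain ps qs where "z = (\<Sum>(x, y)\<leftarrow>ps. atensor x y)" "w = (\<Sum>(x, y)\<leftarrow>qs. atensor x y)"
      by (metis atensor_representation)
    then show ?thesis using m_sum[of ps] m_sum[of qs] m_sum[of "ps @ qs"] by simp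
  qed
  have m_scale: "m (c *\<^sub>C z) = c *\<^sub>C m z" for c z
  proof -
    obtain ps where z: "z = (\<Sum>(x, y)\<leftarrow>ps. atensor x y)" using atensor_representation .
    let ?qs = "map (\<lambda>(x, y). (c *\<^sub>C x, y)) ps"
    have "c *\<^sub>C z = (\<Sum>(x, y)\<leftarrow>?qs. atensor x y)" unfolding z
      by (induction ps) (auto simp: atensor_scaleC_left scaleC_add_right)
    then have "m (c *\<^sub>C z) = (\<Sum>(x, y)\<leftarrow>?qs. B x y)" by (simp only: m_sum)
    also have "\<dots> = c *\<^sub>C (\<Sum>(x, y)\<leftarrow>ps. B x y)"
      using B by (induction ps) (auto simp: cbilinear_iff scaleC_add_right)
    finally show ?thesis by (simp add: z m_sum)
  qed
  have m_diff: "m (z - w) = m z - m w" for z w using m_add[of "z - w" w] by simp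
  have m_bound: "norm (m z) \<le> K * proj_norm z" for z
  proof (rule field_le_epsilon)
    fix e :: real assume e: "0 < e"
    \<comment> \<open>The denominator is \<open>K + 1\<close> because \<open>K\<close> may be zero.\<close>
    then have "0 < e / (K + 1)" using K(2) by simp
    then obtain ps where ps: "z = (\<Sum>(x, y)\<leftarrow>ps. atensor x y)"
      "(\<Sum>(x, y)\<leftarrow>ps. norm x * norm y) < proj_norm z + e / (K + 1)"
      using proj_norm_approx[of z "proj_norm z + e / (K + 1)"] by auto
    have "norm (\<Sum>(x, y)\<leftarrow>ps. B x y) \<le> K * (\<Sum>(x, y)\<leftarrow>ps. norm x * norm y)"
    proof (induction ps)
      case (Cons p ps)
      show ?case using Cons K(1)[of "fst p" "snd p"]
          norm_triangle_ineq[of "B (fst p) (snd p)" "\<Sum>(x, y)\<leftarrow>ps. B x y"]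
        by (simp add: case_prod_unfold distrib_left)
    qed simp
    also have "\<dots> \<le> K * (proj_norm z + e / (K + 1))" using ps(2) K(2) by (simp add: mult_left_mono)
    also have "\<dots> \<le> K * proj_norm z + e"
      using e K(2) by (simp add: field_simps)
    finally show "norm (m z) \<le> K * proj_norm z + e" by (simp add: ps(1) m_sum)
  qed
  have "\<exists>v. \<forall>X. (\<lambda>n. ptensor_of (X n)) \<longlonglongrightarrow> u \<longrightarrow> (\<lambda>n. m (X n)) \<longlonglongrightarrow> v" for u
  proof -
    obtain X where X: "proj_Cauchy X" "(\<lambda>n. ptensor_of (X n)) \<longlonglongrightarrow> u" using ptensor_of_dense .
    have null: "(\<lambda>n. m (Y n) - m (Z n)) \<longlonglongrightarrow> 0" if "(\<lambda>n. ptensor_of (Y n) - ptensor_of (Z n)) \<longlonglongrightarrow> 0"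
      for Y Z :: "nat \<Rightarrow> ('a, 'b) atensor"
    proof (rule Lim_null_comparison)
      show "(\<lambda>n. K * norm (ptensor_of (Y n) - ptensor_of (Z n))) \<longlonglongrightarrow> 0"
        using that by (intro tendsto_mult_right_zero tendsto_norm_zero)
    qed (simp add: norm_ptensor_of m_bound flip: ptensor_of_diff m_diff)
    have "Cauchy (\<lambda>n. m (X n))"
    proof (rule CauchyI)
      fix e :: real assume e: "0 < e"
      then have "0 < e / (K + 1)" using K(2) by simp
      then obtain N where N: "\<And>i j. i \<ge> N \<Longrightarrow> j \<ge> N \<Longrightarrow> proj_norm (X i - X j) < e / (K + 1)"
        using X(1) unfolding proj_Cauchy_def by meson
      have "norm (m (X i) - m (X j)) < e" if "i \<ge> N" "j \<ge> N" for i j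
      proof -
        have "norm (m (X i) - m (X j)) \<le> K * proj_norm (X i - X j)"
          by (simp add: m_bound flip: m_diff)
        also have "\<dots> \<le> K * (e / (K + 1))"
          using N[OF that] K(2) by (intro mult_left_mono) auto
        also have "\<dots> < e" using e K(2) by (simp add: field_simps)
        finally show ?thesis .
      qed
      then show "\<exists>N. \<forall>i\<ge>N. \<forall>j\<ge>N. norm (m (X i) - m (X j)) < e" by blast
    qed
    then obtain v where v: "(\<lambda>n. m (X n)) \<longlonglongrightarrow> v" using Cauchy_convergent convergent_def by blast
    have "(\<lambda>n. m (Y n)) \<longlonglongrightarrow> v" if Y: "(\<lambda>n. ptensor_of (Y n)) \<longlonglongrightarrow> u" for Y
      using tendsto_add[OF null[of Y X] v] tendsto_diff[OF Y X(2)] by simp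
    then show ?thesis by blast
  qed
  then obtain L where L: "\<And>u X. (\<lambda>n. ptensor_of (X n)) \<longlonglongrightarrow> u \<Longrightarrow> (\<lambda>n. m (X n)) \<longlonglongrightarrow> L u"
    by metis
  have "L (u + v) = L u + L v" for u v
  proof -
    obtain X Y where X: "(\<lambda>n. ptensor_of (X n)) \<longlonglongrightarrow> u" and Y: "(\<lambda>n. ptensor_of (Y n)) \<longlonglongrightarrow> v"
      by (metis ptensor_of_dense)
    have "(\<lambda>n. m (X n + Y n)) \<longlonglongrightarrow> L (u + v)"
      by (rule L) (simp add: ptensor_of_add tendsto_add X Y)
    moreover have "(\<lambda>n. m (X n + Y n)) \<longlonglongrightarrow> L u + L v"
      by (simp add: m_add tendsto_add L X Y)
    ultimately show ?thesis by (rule LIMSEQ_unique)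
  qed
  moreover have "L (c *\<^sub>C u) = c *\<^sub>C L u" for c u
  proof -
    obtain X where X: "(\<lambda>n. ptensor_of (X n)) \<longlonglongrightarrow> u" by (metis ptensor_of_dense)
    have "(\<lambda>n. m (c *\<^sub>C X n)) \<longlonglongrightarrow> L (c *\<^sub>C u)"
      by (rule L) (simp add: ptensor_of_scaleC bounded_linear.tendsto[OF bounded_linear_scaleC X])
    moreover have "(\<lambda>n. m (c *\<^sub>C X n)) \<longlonglongrightarrow> c *\<^sub>C L u"
      by (simp add: m_scale bounded_linear.tendsto[OF bounded_linear_scaleC L[OF X]])
    ultimately show ?thesis by (rule LIMSEQ_unique)
  qed
  moreover have "norm (L u) \<le> norm u * K" for u
  proof -
    obtain X where X: "(\<lambda>n. ptensor_of (X n)) \<longlonglongrightarrow> u" by (metis ptensor_of_dense)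
    show ?thesis
      by (rule LIMSEQ_le[OF tendsto_norm[OF L[OF X]] tendsto_mult_right[OF tendsto_norm[OF X]]])
        (use m_bound in \<open>simp add: norm_ptensor_of mult.commute\<close>)
  qed
  ultimately have "bounded_clinear L" unfolding bounded_clinear_def clinear_iff by blast
  moreover have "L (x \<otimes>\<^sub>\<pi> y) = B x y" for x y
    using L[of "\<lambda>_. atensor x y" "x \<otimes>\<^sub>\<pi> y"] m_sum[of "[(x, y)]"]
    by (simp add: ptensor_def LIMSEQ_const_iff)
  ultimately show thesis by (rule that)
qed

section \<open>Powers of complex linear operators\<close>

lemma bounded_clinear_funpow:
  fixes T :: "'a::complex_normed_vector \<Rightarrow> 'a"
  assumes "bounded_clinear T"
  shows "bounded_clinear (T ^^ n)"
proof (induction n)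
  case 0
  show ?case by (auto simp: bounded_clinear_def clinear_iff intro!: exI[of _ 1])
next
  case (Suc n)
  interpret S: bounded_linear "\<lambda>x. T ((T ^^ n) x)"
    using assms Suc by (intro bounded_linear_compose[of T "T ^^ n"] bounded_clinear_imp_bounded_linear)
  show ?case
    using assms Suc S.bounded by (simp add: bounded_clinear_def clinear_iff)
qed

lemma bounded_linear_funpow:
  fixes T :: "'a::complex_normed_vector \<Rightarrow> 'a"
  shows "bounded_clinear T \<Longrightarrow> bounded_linear (T ^^ n)"
  by (intro bounded_clinear_imp_bounded_linear bounded_clinear_funpow)

lemma bounded_clinear_scaleC: "bounded_clinear T \<Longrightarrow> T (c *\<^sub>C x) = c *\<^sub>C T x"
  by (simp add: bounded_clinear_def clinear_iff)

lemma funpow_intertwine: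
  assumes "\<And>u. L (U u) = V (L u)"
  shows "L ((U ^^ n) u) = (V ^^ n) (L u)"
  by (induction n) (simp_all add: assms)

lemma closure_UNIV_iff:
  "closure D = UNIV \<longleftrightarrow> (\<forall>x. \<forall>e>0. \<exists>y\<in>D. dist y x < e)"
  by (auto simp: set_eq_iff closure_approachable)

section \<open>The supercyclicity criterion implies supercyclicity\<close>

text \<open>
  For every point $d$ of a countable dense set and every radius, the vectors $z$ with some
  $\alpha T^n z$ near $d$ form an open set, which is dense by the transitivity assumption.  By Baire's
  theorem some vector lies in all of these sets.
\<close>

lemma supercyclic_if_transitive:
  fixes T :: "'a::complex_banach \<Rightarrow> 'a"
  assumes T: "bounded_clinear T" and sep: "separable_space (euclidean :: 'a topology)"
    and transitive: "\<And>x y e. 0 < e \<Longrightarrow>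
      \<exists>z \<alpha> n. dist z x < e \<and> dist (\<alpha> *\<^sub>C (T ^^ n) z) y < e"
  shows "supercyclic T"
proof -
  obtain D :: "'a set" where D: "countable D" "closure D = UNIV"
    using sep by (auto simp: separable_space_def)
  define W where "W d k = {z. \<exists>\<alpha> n. dist (\<alpha> *\<^sub>C (T ^^ n) z) d < inverse (real (Suc k))}" for d k
  have open_W: "open (W d k)" for d k
  proof -
    have "continuous_on UNIV (\<lambda>z. \<alpha> *\<^sub>C (T ^^ n) z)" for \<alpha> n
      by (intro linear_continuous_on bounded_linear_compose[of "scaleC \<alpha>" "T ^^ n"]
          bounded_linear_scaleC bounded_linear_funpow T)
    then have "open {z. dist (\<alpha> *\<^sub>C (T ^^ n) z) d < inverse (real (Suc k))}" for \<alpha> n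
      by (intro open_Collect_less continuous_on_dist continuous_on_const)
    moreover have "W d k = (\<Union>\<alpha>. \<Union>n. {z. dist (\<alpha> *\<^sub>C (T ^^ n) z) d < inverse (real (Suc k))})"
      by (auto simp: W_def)
    ultimately show ?thesis by auto
  qed
  have dense_W: "closure (W d k) = UNIV" for d k
    unfolding closure_UNIV_iff
  proof (intro allI impI)
    fix x and e :: real assume "0 < e"
    then have "0 < min e (inverse (real (Suc k)))" by simp
    from transitive[OF this, of x d] show "\<exists>z\<in>W d k. dist z x < e"
      unfolding W_def min_less_iff_conj by auto
  qed
  have "euclidean closure_of \<Inter>((\<lambda>(d, k). W d k) ` (D \<times> UNIV)) = topspace (euclidean :: 'a topology)"
    using D(1) open_W dense_W
    by (intro Baire_category disjI1 completely_metrizable_space_euclidean) auto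
  then have "\<Inter>((\<lambda>(d, k). W d k) ` (D \<times> UNIV)) \<noteq> {}"
    by (metis UNIV_not_empty closure_of_empty topspace_euclidean)
  then obtain x where x: "\<And>d k. d \<in> D \<Longrightarrow> x \<in> W d k" by auto
  have "closure {\<alpha> *\<^sub>C (T ^^ n) x | \<alpha> n. True} = UNIV"
    unfolding closure_UNIV_iff
  proof (intro allI impI)
    fix y and e :: real assume e: "0 < e"
    then obtain d where d: "d \<in> D" "dist d y < e / 2"
      using D(2) unfolding closure_UNIV_iff by (meson half_gt_zero)
    obtain k where k: "inverse (real (Suc k)) < e / 2" using reals_Archimedean[of "e / 2"] e by auto
    obtain \<alpha> n where "dist (\<alpha> *\<^sub>C (T ^^ n) x) d < inverse (real (Suc k))"
      using x[OF d(1), of k] by (auto simp: W_def)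
    then have "dist (\<alpha> *\<^sub>C (T ^^ n) x) y < e"
      using k d(2) dist_triangle[of "\<alpha> *\<^sub>C (T ^^ n) x" y d] by simp
    then show "\<exists>z\<in>{\<alpha> *\<^sub>C (T ^^ n) x | \<alpha> n. True}. dist z y < e" by blast
  qed
  with T show ?thesis by (auto simp: supercyclic_def)
qed

text \<open>
  If a product is small, one factor can be scaled up and the other down until both are small.
  Here $c$ has to lie strictly between $b / e$ and $e / a$.
\<close>

lemma balancing_scalar:
  assumes "0 \<le> a" "0 \<le> b" "a * b < e\<^sup>2" "0 < e"
  obtains c :: real where "0 < c" "c * a < e" "b < c * e"
proof (cases "a = 0")
  case True
  then show ?thesis using assms by (intro that[of "b / e + 1"]) (auto simp: field_simps)
next
  case False
  then have "b / e < e / a" using assms by (simp add: field_simps power2_eq_square)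
  then obtain c where c: "b / e < c" "c < e / a" using dense by blast
  moreover have "0 \<le> b / e" using assms by simp
  ultimately have "0 < c" by linarith
  with c show ?thesis using assms False by (intro that[of c]) (auto simp: field_simps)
qed

text \<open>
  The vector that moves from near $x$ to near $y$ is $z = x' + c S y'$, with $x'$ and $y'$ from the
  dense sets.  Then $c^{-1} T^n z = c^{-1} T^n x' + T^n S y'$, and $c$ is chosen to make both
  $c S y'$ and $c^{-1} T^n x'$ small.
\<close>

theorem supercyclic_if_criterion:
  fixes T :: "'a::complex_banach \<Rightarrow> 'a"
  assumes crit: "supercyclicity_criterion T" and sep: "separable_space (euclidean :: 'a topology)"
  shows "supercyclic T"
proof -
  obtain D1 D2 :: "'a set" and n S where T: "bounded_clinear T"
    and D1: "closure D1 = UNIV" and D2: "closure D2 = UNIV"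
    and prod: "\<And>x y. x \<in> D1 \<Longrightarrow> y \<in> D2 \<Longrightarrow>
      (\<lambda>k. norm ((T ^^ n k) x) * norm (S (n k) y)) \<longlonglongrightarrow> 0"
    and inv: "\<And>y. y \<in> D2 \<Longrightarrow> (\<lambda>k. (T ^^ n k) (S (n k) y)) \<longlonglongrightarrow> y"
    using crit unfolding supercyclicity_criterion_def by blast
  show ?thesis
  proof (rule supercyclic_if_transitive[OF T sep])
    fix x y :: 'a and e :: real assume e: "0 < e"
    obtain x' where x': "x' \<in> D1" "dist x' x < e / 2"
      using D1 e unfolding closure_UNIV_iff by (meson half_gt_zero)
    obtain y' where y': "y' \<in> D2" "dist y' y < e / 3"
      using D2 e unfolding closure_UNIV_iff by (meson zero_less_divide_iff zero_less_numeral)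
    have "\<forall>\<^sub>F k in sequentially. norm ((T ^^ n k) x') * norm (S (n k) y') < (e / 3)\<^sup>2"
      using prod[OF x'(1) y'(1)] e by (intro order_tendstoD) auto
    moreover have "\<forall>\<^sub>F k in sequentially. dist ((T ^^ n k) (S (n k) y')) y' < e / 3"
      using inv[OF y'(1)] e by (intro tendstoD) auto
    ultimately have "\<forall>\<^sub>F k in sequentially. norm ((T ^^ n k) x') * norm (S (n k) y') < (e / 3)\<^sup>2 \<and>
        dist ((T ^^ n k) (S (n k) y')) y' < e / 3"
      by (rule eventually_conj)
    then have "\<exists>k. norm ((T ^^ n k) x') * norm (S (n k) y') < (e / 3)\<^sup>2 \<and>
        dist ((T ^^ n k) (S (n k) y')) y' < e / 3"
      by (rule eventually_happens'[OF sequentially_bot])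
    then obtain k where "norm ((T ^^ n k) x') * norm (S (n k) y') < (e / 3)\<^sup>2"
      and k: "dist ((T ^^ n k) (S (n k) y')) y' < e / 3"
      by blast
    moreover define s and t where "s = S (n k) y'" and "t = (T ^^ n k) x'"
    ultimately obtain c where c: "0 < c" "c * norm s < e / 3" "norm t < c * (e / 3)"
      using balancing_scalar[of "norm s" "norm t" "e / 3"] e by (auto simp: mult.commute)
    interpret Tn: bounded_linear "T ^^ n k" using T by (rule bounded_linear_funpow)
    let ?z = "x' + c *\<^sub>R s"
    have "dist ?z x \<le> dist x' x + norm (c *\<^sub>R s)"
      using norm_triangle_ineq[of "x' - x" "c *\<^sub>R s"] by (simp add: dist_norm algebra_simps)
    then have zx: "dist ?z x < e" using x'(2) c e by simp
    have img: "inverse (complex_of_real c) *\<^sub>C (T ^^ n k) ?z = inverse c *\<^sub>R t + (T ^^ n k) s"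
      using c(1) by (simp add: Tn.add Tn.scaleR t_def scaleR_add_right flip: of_real_inverse scaleR_scaleC)
    have "norm (inverse c *\<^sub>R t) < e / 3" using c by (simp add: field_simps)
    moreover have "dist (inverse c *\<^sub>R t + (T ^^ n k) s) y \<le>
        norm (inverse c *\<^sub>R t) + (dist ((T ^^ n k) s) y' + dist y' y)"
      using norm_triangle_ineq[of "inverse c *\<^sub>R t" "(T ^^ n k) s - y"] dist_triangle[of "(T ^^ n k) s" y y']
      by (simp add: dist_norm algebra_simps)
    moreover have "dist ((T ^^ n k) s) y' < e / 3" using k by (simp add: s_def)
    ultimately have "dist (inverse c *\<^sub>R t + (T ^^ n k) s) y < e" using y'(2) by linarith
    then have "dist (inverse (complex_of_real c) *\<^sub>C (T ^^ n k) ?z) y < e" unfolding img .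
    with zx show "\<exists>z \<alpha> m. dist z x < e \<and> dist (\<alpha> *\<^sub>C (T ^^ m) z) y < e" by blast
  qed
qed

section \<open>The criterion passes to the tensor product\<close>

lemma tensor_id_funpow_ptensor:
  assumes "bounded_clinear T"
  shows "(tensor_id T ^^ n) (x \<otimes>\<^sub>\<pi> y) = (T ^^ n) x \<otimes>\<^sub>\<pi> y"
  by (induction n) (simp_all add: tensor_id_ptensor[OF assms])

lemma tensor_id_funpow_sum:
  assumes "bounded_clinear T"
  shows "(tensor_id T ^^ n) (\<Sum>(x, y)\<leftarrow>ps. x \<otimes>\<^sub>\<pi> y) = (\<Sum>(x, y)\<leftarrow>ps. (T ^^ n) x \<otimes>\<^sub>\<pi> y)"
proof -
  interpret bounded_linear "tensor_id T ^^ n"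
    by (intro bounded_linear_funpow bounded_clinear_tensor_id assms)
  show ?thesis by (induction ps) (auto simp: zero add tensor_id_funpow_ptensor[OF assms])
qed

lemma norm_tensor_sum_le: "norm (\<Sum>(x, y)\<leftarrow>ps. f x \<otimes>\<^sub>\<pi> y) \<le> (\<Sum>(x, y)\<leftarrow>ps. norm (f x) * norm y)"
proof (induction ps)
  case (Cons p ps)
  have "norm ((f (fst p) \<otimes>\<^sub>\<pi> snd p) + (\<Sum>(x, y)\<leftarrow>ps. f x \<otimes>\<^sub>\<pi> y)) \<le>
      norm (f (fst p)) * norm (snd p) + (\<Sum>(x, y)\<leftarrow>ps. norm (f x) * norm y)"
    using norm_ptensor_le Cons by (intro norm_triangle_mono)
  then show ?case by (simp add: case_prod_unfold)
qed simp

lemma tendsto_sum_list: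
  assumes "\<And>p. p \<in> set ps \<Longrightarrow> (\<lambda>k. f k p) \<longlonglongrightarrow> (g p :: 'a::real_normed_vector)"
  shows "(\<lambda>k. \<Sum>p\<leftarrow>ps. f k p) \<longlonglongrightarrow> (\<Sum>p\<leftarrow>ps. g p)"
  using assms by (induction ps) (auto intro!: tendsto_add)

text \<open>
  The product of the two norms in the criterion for $T \otimes I$ is dominated by a finite double
  sum of such products for $T$, so no uniformity over the dense sets is needed.
\<close>

theorem criterion_tensor_id:
  fixes T :: "'a::complex_banach \<Rightarrow> 'a"
  assumes "supercyclicity_criterion T"
  shows "supercyclicity_criterion
    (tensor_id T :: ('a, 'b::complex_banach) ptensor \<Rightarrow> ('a, 'b) ptensor)"
proof -
  obtain D1 D2 :: "'a set" and n S where T: "bounded_clinear T"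
    and D1: "closure D1 = UNIV" and D2: "closure D2 = UNIV" and n: "\<And>k. 0 < n k"
    and prod: "\<And>x y. x \<in> D1 \<Longrightarrow> y \<in> D2 \<Longrightarrow>
      (\<lambda>k. norm ((T ^^ n k) x) * norm (S (n k) y)) \<longlonglongrightarrow> 0"
    and inv: "\<And>y. y \<in> D2 \<Longrightarrow> (\<lambda>k. (T ^^ n k) (S (n k) y)) \<longlonglongrightarrow> y"
    using assms unfolding supercyclicity_criterion_def by blast
  define U :: "('a, 'b) ptensor \<Rightarrow> ('a, 'b) ptensor" where "U = tensor_id T"
  define \<Delta>1 \<Delta>2 :: "('a, 'b) ptensor set"
    where "\<Delta>1 = tensor_sums D1 UNIV" and "\<Delta>2 = tensor_sums D2 UNIV"
  \<comment> \<open>The right inverses need not be linear, so an arbitrary representation of each tensor can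
    be fixed.\<close>
  define rep :: "('a, 'b) ptensor \<Rightarrow> ('a \<times> 'b) list"
    where "rep v = (SOME ps. v = (\<Sum>(x, y)\<leftarrow>ps. x \<otimes>\<^sub>\<pi> y) \<and> set ps \<subseteq> D2 \<times> UNIV)" for v
  define R where "R m v = (\<Sum>(x, y)\<leftarrow>rep v. S m x \<otimes>\<^sub>\<pi> y)" for m v
  have rep: "v = (\<Sum>(x, y)\<leftarrow>rep v. x \<otimes>\<^sub>\<pi> y)" "set (rep v) \<subseteq> D2 \<times> UNIV" if "v \<in> \<Delta>2" for v
  proof -
    have "\<exists>ps. v = (\<Sum>(x, y)\<leftarrow>ps. x \<otimes>\<^sub>\<pi> y) \<and> set ps \<subseteq> D2 \<times> UNIV"
      using that unfolding \<Delta>2_def tensor_sums_def by blast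
    from someI_ex[OF this] show "v = (\<Sum>(x, y)\<leftarrow>rep v. x \<otimes>\<^sub>\<pi> y)" "set (rep v) \<subseteq> D2 \<times> UNIV"
      by (auto simp: rep_def)
  qed
  have "(\<lambda>k. norm ((U ^^ n k) u) * norm (R (n k) v)) \<longlonglongrightarrow> 0" if u: "u \<in> \<Delta>1" and v: "v \<in> \<Delta>2" for u v
  proof -
    obtain ps where ps: "u = (\<Sum>(x, y)\<leftarrow>ps. x \<otimes>\<^sub>\<pi> y)" "set ps \<subseteq> D1 \<times> UNIV"
      using u unfolding \<Delta>1_def tensor_sums_def by blast
    define bound where "bound k = (\<Sum>(x, y)\<leftarrow>ps. norm ((T ^^ n k) x) * norm y) *
      (\<Sum>(x, y)\<leftarrow>rep v. norm (S (n k) x) * norm y)" for k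
    have expand: "bound k = (\<Sum>p\<leftarrow>ps. \<Sum>q\<leftarrow>rep v.
        norm (snd p) * norm (snd q) * (norm ((T ^^ n k) (fst p)) * norm (S (n k) (fst q))))" for k
      by (simp add: bound_def case_prod_unfold mult_ac flip: sum_list_const_mult sum_list_mult_const)
    have "bound \<longlonglongrightarrow> (\<Sum>p\<leftarrow>ps. \<Sum>q\<leftarrow>rep v. norm (snd p) * norm (snd q) * 0)"
      unfolding expand
    proof (intro tendsto_sum_list tendsto_mult_left)
      fix p q assume "p \<in> set ps" "q \<in> set (rep v)"
      then show "(\<lambda>k. norm ((T ^^ n k) (fst p)) * norm (S (n k) (fst q))) \<longlonglongrightarrow> 0"
        using ps(2) rep(2)[OF v] by (intro prod) auto
    qed
    then have "bound \<longlonglongrightarrow> 0" by simp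
    then show ?thesis
    proof (rule Lim_null_comparison[rotated], intro always_eventually allI)
      fix k
      have "norm ((U ^^ n k) u) \<le> (\<Sum>(x, y)\<leftarrow>ps. norm ((T ^^ n k) x) * norm y)"
        unfolding ps(1) U_def tensor_id_funpow_sum[OF T] by (rule norm_tensor_sum_le)
      moreover have "norm (R (n k) v) \<le> (\<Sum>(x, y)\<leftarrow>rep v. norm (S (n k) x) * norm y)"
        unfolding R_def by (rule norm_tensor_sum_le)
      ultimately show "norm (norm ((U ^^ n k) u) * norm (R (n k) v)) \<le> bound k"
        unfolding bound_def by (simp add: mult_mono')
    qed
  qed
  moreover have "(\<lambda>k. (U ^^ n k) (R (n k) v)) \<longlonglongrightarrow> v" if v: "v \<in> \<Delta>2" for v
  proof -
    have eq: "(U ^^ m) (R m v) = (\<Sum>(x, y)\<leftarrow>rep v. (T ^^ m) (S m x) \<otimes>\<^sub>\<pi> y)" for m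
      using tensor_id_funpow_sum[OF T, of m "map (\<lambda>(x, y). (S m x, y)) (rep v)"]
      by (simp add: R_def U_def comp_def case_prod_unfold)
    have "(\<lambda>k. \<Sum>(x, y)\<leftarrow>rep v. (T ^^ n k) (S (n k) x) \<otimes>\<^sub>\<pi> y) \<longlonglongrightarrow> (\<Sum>(x, y)\<leftarrow>rep v. x \<otimes>\<^sub>\<pi> y)"
      unfolding case_prod_unfold
    proof (rule tendsto_sum_list)
      fix p assume "p \<in> set (rep v)"
      then have "(\<lambda>k. (T ^^ n k) (S (n k) (fst p))) \<longlonglongrightarrow> fst p"
        using rep(2)[OF v] by (intro inv) auto
      then show "(\<lambda>k. (T ^^ n k) (S (n k) (fst p)) \<otimes>\<^sub>\<pi> snd p) \<longlonglongrightarrow> fst p \<otimes>\<^sub>\<pi> snd p"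
        by (intro bounded_bilinear.tendsto[OF bounded_bilinear_ptensor] tendsto_const)
    qed
    then show ?thesis by (simp add: eq flip: rep(1)[OF v])
  qed
  moreover have "closure \<Delta>1 = UNIV" "closure \<Delta>2 = UNIV"
    unfolding \<Delta>1_def \<Delta>2_def by (simp_all add: closure_tensor_sums D1 D2)
  moreover have "bounded_clinear U" unfolding U_def by (rule bounded_clinear_tensor_id[OF T])
  ultimately show ?thesis
    unfolding supercyclicity_criterion_def U_def[symmetric] using n by blast
qed

section \<open>From the tensor product to the direct sum\<close>

lemma supercyclic_if_onto_intertwiner:
  fixes U :: "'a::complex_banach \<Rightarrow> 'a" and V :: "'b::complex_banach \<Rightarrow> 'b"
  assumes U: "supercyclic U" and V: "bounded_clinear V"
    and L: "bounded_clinear L" "surj L" and comm: "\<And>u. L (U u) = V (L u)"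
  shows "supercyclic V"
proof -
  obtain x where x: "closure {\<alpha> *\<^sub>C (U ^^ n) x | \<alpha> n. True} = UNIV"
    using U by (auto simp: supercyclic_def)
  have img: "L ` {\<alpha> *\<^sub>C (U ^^ n) x | \<alpha> n. True} = {\<alpha> *\<^sub>C (V ^^ n) (L x) | \<alpha> n. True}"
  proof -
    have "L (\<alpha> *\<^sub>C (U ^^ n) x) = \<alpha> *\<^sub>C (V ^^ n) (L x)" for \<alpha> n
      by (simp add: bounded_clinear_scaleC[OF L(1)] funpow_intertwine[of L U V, OF comm])
    then show ?thesis unfolding image_def by (intro set_eqI) (simp, metis)
  qed
  have "continuous_on UNIV L"
    by (intro linear_continuous_on bounded_clinear_imp_bounded_linear L(1))
  then have "L ` closure {\<alpha> *\<^sub>C (U ^^ n) x | \<alpha> n. True} \<subseteq> closure (L ` {\<alpha> *\<^sub>C (U ^^ n) x | \<alpha> n. True})"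
    by (intro image_closure_subset closure_subset) (auto intro: continuous_on_subset)
  then have "closure {\<alpha> *\<^sub>C (V ^^ n) (L x) | \<alpha> n. True} = UNIV"
    using x L(2) unfolding img by auto
  then show ?thesis using V unfolding supercyclic_def by blast
qed

text \<open>
  For independent $f$ and $g$, choose $\phi$ with $\phi(f) \neq 0$, replace $g$ by
  $h = g - (\phi(g) / \phi(f)) f \neq 0$ in the kernel of $\phi$, and choose $\psi$ with
  $\psi(h) \neq 0$.  The matrix of $(\phi, \psi)$ on $(f, h)$ is triangular and invertible;
  its inverse gives $a$ and $b$.
\<close>

lemma biorthogonal_functionals:
  assumes "\<exists>B :: 'b::complex_normed_vector set. complex_vector.independent B \<and>
    complex_vector.span B = UNIV \<and> (finite B \<longrightarrow> 2 \<le> card B)"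
  obtains \<phi> \<psi> :: "'b::complex_normed_vector \<Rightarrow> complex" and a b where "bounded_clinear \<phi>" "bounded_clinear \<psi>"
    "\<phi> a = 1" "\<psi> a = 0" "\<phi> b = 0" "\<psi> b = 1"
proof -
  obtain B :: "'b set" where B: "complex_vector.independent B" "finite B \<longrightarrow> 2 \<le> card B"
    using assms by blast
  obtain C where "C \<subseteq> B" "card C = 2" "finite C"
    using B(2) by (metis infinite_arbitrarily_large obtain_subset_with_card_n)
  then obtain f g where fg: "f \<noteq> g" "f \<in> B" "g \<in> B" by (auto simp: card_2_iff)
  have f0: "f \<noteq> 0" using B(1) fg complex_vector.dependent_zero by blast
  have not_multiple: "g \<noteq> c *\<^sub>C f" for c
  proof
    assume "g = c *\<^sub>C f"
    moreover have "c *\<^sub>C f \<in> complex_vector.span (B - {g})"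
      using fg by (intro complex_vector.span_scale complex_vector.span_base) auto
    ultimately have "g \<in> complex_vector.span (B - {g})" by (rule ssubst)
    then show False using B(1) fg(3) by (auto simp: complex_vector.dependent_def)
  qed
  obtain \<phi> :: "'b \<Rightarrow> complex" where \<phi>: "bounded_clinear \<phi>" "\<phi> f \<noteq> 0"
    using f0 by (rule bounded_clinear_functional_exists)
  define h where "h = g + (- (\<phi> g / \<phi> f)) *\<^sub>C f"
  have "h \<noteq> 0"
    using not_multiple[of "\<phi> g / \<phi> f"] by (simp add: h_def)
  then obtain \<psi> :: "'b \<Rightarrow> complex" where \<psi>: "bounded_clinear \<psi>" "\<psi> h \<noteq> 0"
    by (rule bounded_clinear_functional_exists)
  have \<phi>_lin: "\<phi> (x + y) = \<phi> x + \<phi> y" "\<phi> (c *\<^sub>C x) = c * \<phi> x"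
    and \<psi>_lin: "\<psi> (x + y) = \<psi> x + \<psi> y" "\<psi> (c *\<^sub>C x) = c * \<psi> x" for x y c
    using \<phi>(1) \<psi>(1) by (simp_all add: bounded_clinear_def clinear_iff scaleC_complex_def)
  have \<phi>h: "\<phi> h = 0" unfolding h_def \<phi>_lin using \<phi>(2) by simp
  define b where "b = inverse (\<psi> h) *\<^sub>C h"
  define a where "a = inverse (\<phi> f) *\<^sub>C f + (- (\<psi> f / \<phi> f)) *\<^sub>C b"
  have "\<phi> b = 0" "\<psi> b = 1" using \<phi>h \<psi>(2) by (simp_all add: b_def \<phi>_lin \<psi>_lin)
  moreover from this have "\<phi> a = 1" "\<psi> a = 0"
    unfolding a_def \<phi>_lin \<psi>_lin using \<phi>(2) by (simp_all add: field_simps)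
  ultimately show thesis using that \<phi>(1) \<psi>(1) by blast
qed

text \<open>
  The intertwining map is the lift of $(x, y) \mapsto (\phi(y) x, \psi(y) x)$; a preimage of
  $(x, x')$ is $x \otimes a + x' \otimes b$, where $(a, b)$ is biorthogonal to $(\phi, \psi)$.
\<close>

theorem supercyclic_direct_sum_if_tensor_id:
  fixes T :: "'a::complex_banach \<Rightarrow> 'a"
  assumes dim: "\<exists>B :: 'b::complex_banach set. complex_vector.independent B \<and>
      complex_vector.span B = UNIV \<and> (finite B \<longrightarrow> 2 \<le> card B)"
    and T: "bounded_clinear T"
    and super: "supercyclic (tensor_id T :: ('a, 'b) ptensor \<Rightarrow> ('a, 'b) ptensor)"
  shows "supercyclic (\<lambda>(x, y). (T x, T y))"
proof -
  obtain \<phi> \<psi> :: "'b \<Rightarrow> complex" and a b where \<phi>: "bounded_clinear \<phi>" and \<psi>: "bounded_clinear \<psi>"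
    and ab: "\<phi> a = 1" "\<psi> a = 0" "\<phi> b = 0" "\<psi> b = 1"
    using biorthogonal_functionals[OF dim] by blast
  have \<phi>_lin: "\<phi> (x + y) = \<phi> x + \<phi> y" "\<phi> (c *\<^sub>C x) = c * \<phi> x"
    and \<psi>_lin: "\<psi> (x + y) = \<psi> x + \<psi> y" "\<psi> (c *\<^sub>C x) = c * \<psi> x" for x y c
    using \<phi> \<psi> by (simp_all add: bounded_clinear_def clinear_iff scaleC_complex_def)
  have T_lin: "T (x + y) = T x + T y" "T (c *\<^sub>C x) = c *\<^sub>C T x" for x y c
    using T by (simp_all add: bounded_clinear_def clinear_iff)
  obtain K1 where K1: "\<And>y. cmod (\<phi> y) \<le> norm y * K1" "0 \<le> K1"
    using bounded_linear.nonneg_bounded[OF bounded_clinear_imp_bounded_linear[OF \<phi>]] by blast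
  obtain K2 where K2: "\<And>y. cmod (\<psi> y) \<le> norm y * K2" "0 \<le> K2"
    using bounded_linear.nonneg_bounded[OF bounded_clinear_imp_bounded_linear[OF \<psi>]] by blast
  define S where "S = (\<lambda>(x, y). (T x, T y))"
  define B where "B x y = (\<phi> y *\<^sub>C x, \<psi> y *\<^sub>C x)" for x :: 'a and y
  have "cbilinear B"
    by (simp add: cbilinear_iff B_def scaleC_prod_def \<phi>_lin \<psi>_lin scaleC_add_left scaleC_add_right
        scaleC_scaleC mult.commute)
  moreover have "norm (B x y) \<le> (K1 + K2) * (norm x * norm y)" for x y
  proof -
    have "norm (B x y) \<le> cmod (\<phi> y) * norm x + cmod (\<psi> y) * norm x"
      using norm_Pair_le[of "\<phi> y *\<^sub>C x" "\<psi> y *\<^sub>C x"] by (simp add: B_def norm_scaleC)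
    also have "\<dots> \<le> norm y * K1 * norm x + norm y * K2 * norm x"
      by (intro add_mono mult_right_mono K1 K2) auto
    finally show ?thesis by (simp add: algebra_simps)
  qed
  ultimately obtain L where L: "bounded_clinear L" "\<And>x y. L (x \<otimes>\<^sub>\<pi> y) = B x y"
    using ptensor_lift[of B "K1 + K2"] K1(2) K2(2) by (metis add_nonneg_nonneg)
  have L_add: "L (u + v) = L u + L v" for u v
    using L(1) by (simp add: bounded_clinear_def clinear_iff)
  have "L (x \<otimes>\<^sub>\<pi> a + x' \<otimes>\<^sub>\<pi> b) = (x, x')" for x x'
    by (simp add: L_add L(2) B_def ab scaleC_one)
  then have "surj L" by (metis surj_def surj_pair)
  have S: "bounded_clinear S"
  proof -
    interpret bounded_linear T using T by (rule bounded_clinear_imp_bounded_linear)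
    have "bounded_linear (\<lambda>z. (T (fst z), T (snd z)))"
      by (intro bounded_linear_Pair bounded_linear_compose[OF bounded_linear_axioms]
          bounded_linear_fst bounded_linear_snd)
    then have "\<exists>K. \<forall>z. norm (S z) \<le> norm z * K"
      using bounded_linear.bounded unfolding S_def case_prod_unfold by blast
    then show ?thesis
      by (auto simp: bounded_clinear_def clinear_iff S_def case_prod_unfold scaleC_prod_def T_lin)
  qed
  have compose: "bounded_clinear (\<lambda>u. f (g u))" if "bounded_clinear f" "bounded_clinear g"
    for f :: "'c::complex_normed_vector \<Rightarrow> 'd::complex_normed_vector" and g :: "'e::complex_normed_vector \<Rightarrow> 'c"
    using that bounded_linear.bounded[OF bounded_linear_compose[of f g]]
    by (simp add: bounded_clinear_def clinear_iff bounded_clinear_imp_bounded_linear)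
  have "(\<lambda>u. L (tensor_id T u)) = (\<lambda>u. S (L u))"
  proof (rule tensor_id_unique)
    show "L (tensor_id T (x \<otimes>\<^sub>\<pi> y)) = S (L (x \<otimes>\<^sub>\<pi> y))" for x y
      by (simp add: tensor_id_ptensor[OF T] L(2) B_def S_def T_lin)
  qed (auto intro!: compose[OF L(1) bounded_clinear_tensor_id[OF T]] compose[OF S L(1)])
  then show ?thesis
    using supercyclic_if_onto_intertwiner[OF super S L(1) \<open>surj L\<close>] by (metis S_def)
qed

section \<open>From the direct sum to the criterion\<close>

text \<open>
  Up to the factor $\|p\|$ the line is an isometric copy of the complete space $\mathbb{C}$.
\<close>

lemma closed_complex_line: "closed (range (\<lambda>\<alpha>. \<alpha> *\<^sub>C (p :: 'a::complex_normed_vector)))"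
proof (cases "p = 0")
  case False
  have "bounded_linear (\<lambda>\<alpha>. \<alpha> *\<^sub>C p)"
    by (rule bounded_linear_intro[where K = "norm p"])
      (simp_all add: scaleC_add_left scaleR_scaleC scaleC_scaleC norm_scaleC scaleC_complex_def)
  with False have "complete (range (\<lambda>\<alpha>. \<alpha> *\<^sub>C p))"
    by (intro complete_isometric_image[of "norm p"])
      (auto simp: norm_scaleC mult.commute complete_UNIV)
  then show ?thesis by (rule complete_imp_closed)
qed (simp add: image_constant_conv)

text \<open>
  Infinitely many of the vectors $(s x, x)$ would otherwise share a line, but no two of them are
  proportional.  This is used to find approximations along a projective orbit with arbitrarily late
  exponents: the early part of the orbit lies on finitely many lines.
\<close>

lemma finitely_many_lines_miss:
  fixes p :: "nat \<Rightarrow> 'a::complex_normed_vector \<times> 'a"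
  assumes "x \<noteq> 0" "0 < r"
  obtains s where "0 < s" "s < r" "(s *\<^sub>R x, x) \<notin> (\<Union>n<N. range (\<lambda>\<alpha>. \<alpha> *\<^sub>C p n))"
proof (rule ccontr)
  assume no: "\<not> thesis"
  have "\<And>s. 0 < s \<Longrightarrow> s < r \<Longrightarrow> (s *\<^sub>R x, x) \<in> (\<Union>n<N. range (\<lambda>\<alpha>. \<alpha> *\<^sub>C p n))"
    using no that by blast
  then have "\<exists>n. n < N \<and> (s *\<^sub>R x, x) \<in> range (\<lambda>\<alpha>. \<alpha> *\<^sub>C p n)" if "s \<in> {0<..<r}" for s
    using that unfolding greaterThanLessThan_iff by blast
  then obtain n where n: "\<And>s. s \<in> {0<..<r} \<Longrightarrow> n s < N"
    "\<And>s. s \<in> {0<..<r} \<Longrightarrow> (s *\<^sub>R x, x) \<in> range (\<lambda>\<alpha>. \<alpha> *\<^sub>C p (n s))" by metis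
  have "\<not> inj_on n {0<..<r}"
  proof
    assume "inj_on n {0<..<r}"
    moreover have "n ` {0<..<r} \<subseteq> {..<N}" using n(1) by auto
    ultimately have "finite {0<..<r}" by (metis finite_lessThan inj_on_finite)
    then show False using \<open>0 < r\<close> infinite_Ioo by blast
  qed
  then obtain s t where st: "s \<in> {0<..<r}" "t \<in> {0<..<r}" "n s = n t" "s \<noteq> t"
    by (auto simp: inj_on_def)
  obtain \<alpha> \<beta> where \<alpha>: "(s *\<^sub>R x, x) = \<alpha> *\<^sub>C p (n t)" and \<beta>: "(t *\<^sub>R x, x) = \<beta> *\<^sub>C p (n t)"
    using n(2)[OF st(1)] n(2)[OF st(2)] st(3) by auto
  have "\<alpha> *\<^sub>C snd (p (n t)) = \<beta> *\<^sub>C snd (p (n t))" "\<alpha> *\<^sub>C snd (p (n t)) \<noteq> 0"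
    using \<alpha> \<beta> \<open>x \<noteq> 0\<close> by (auto simp: scaleC_prod_def)
  then have "\<alpha> = \<beta>" by auto
  then have "s *\<^sub>R x = t *\<^sub>R x" using \<alpha> \<beta> by (metis prod.inject)
  then show False using st(4) \<open>x \<noteq> 0\<close> by simp
qed

text \<open>
  The right inverses in the criterion depend on the exponent rather than on its index, so the
  exponents $n_k$ have to be distinct before $\alpha_k$ can be recovered from $n_k$.  This is why
  approximations with late exponents are needed.
\<close>

theorem criterion_if_supercyclic_direct_sum:
  fixes T :: "'a::complex_banach \<Rightarrow> 'a"
  assumes T: "bounded_clinear T" and super: "supercyclic (\<lambda>(x, y). (T x, T y))"
  shows "supercyclicity_criterion T"
proof (cases "\<forall>x :: 'a. x = 0")
  case True
  \<comment> \<open>The zero space has no vectors off a line, but there any choice satisfies the criterion.\<close>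
  then have all_eq: "u = v" for u v :: 'a by metis
  show ?thesis unfolding supercyclicity_criterion_def
  proof (intro conjI T exI[of _ UNIV] exI[of _ "\<lambda>_. 1"] exI[of _ "\<lambda>_ _. 0"] ballI)
    show "(\<lambda>k. (T ^^ 1) 0) \<longlonglongrightarrow> y" for y using all_eq[of "(T ^^ 1) 0" y] by simp
  qed auto
next
  case False
  then obtain v :: 'a where v: "v \<noteq> 0" by blast
  obtain x y where dense: "closure {\<alpha> *\<^sub>C ((\<lambda>(x, y). (T x, T y)) ^^ n) (x, y) | \<alpha> n. True} = UNIV"
    using super by (auto simp: supercyclic_def)
  have pow: "((\<lambda>(x, y). (T x, T y)) ^^ n) (x, y) = ((T ^^ n) x, (T ^^ n) y)" for n
    by (induction n) auto
  have approx: "\<exists>\<alpha> n. dist (\<alpha> *\<^sub>C ((T ^^ n) x, (T ^^ n) y)) z < e" if "0 < e" for z e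
    using dense that unfolding closure_UNIV_iff pow by blast
  have x: "x \<noteq> 0"
  proof
    assume "x = 0"
    obtain \<alpha> n where "dist (\<alpha> *\<^sub>C ((T ^^ n) x, (T ^^ n) y)) (v, 0) < norm v"
      using approx[of "norm v" "(v, 0)"] v by auto
    from le_less_trans[OF dist_fst_le this] have "dist (\<alpha> *\<^sub>C (T ^^ n) x) v < norm v"
      by (simp add: scaleC_prod_def)
    then show False
      by (simp add: \<open>x = 0\<close> linear_simps(3)[OF bounded_linear_funpow[OF T]])
  qed
  \<comment> \<open>The target is $(s x, x)$ with small $s > 0$ rather than $(0, x)$, so that a whole
    neighbourhood of it avoids the part of the orbit with exponents below $N$.\<close>
  have late: "\<exists>n\<ge>N. \<exists>\<alpha>. norm (\<alpha> *\<^sub>C (T ^^ n) x) < e \<and> norm (\<alpha> *\<^sub>C (T ^^ n) y - x) < e"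
    if e: "0 < e" for N e
  proof -
    define lines where "lines = (\<Union>n<N. range (\<lambda>\<alpha>. \<alpha> *\<^sub>C ((T ^^ n) x, (T ^^ n) y)))"
    obtain s where s: "0 < s" "s < e / (2 * norm x)" "(s *\<^sub>R x, x) \<notin> lines"
      using finitely_many_lines_miss[OF x, of "e / (2 * norm x)" "\<lambda>n. ((T ^^ n) x, (T ^^ n) y)" N] e x
      unfolding lines_def by auto
    have "open (- lines)"
      unfolding lines_def by (intro open_Compl closed_UN finite_lessThan ballI closed_complex_line)
    then obtain d where d: "0 < d" "\<And>z. dist z (s *\<^sub>R x, x) < d \<Longrightarrow> z \<notin> lines"
      using s(3) unfolding open_dist by blast
    obtain \<alpha> n where \<alpha>: "dist (\<alpha> *\<^sub>C ((T ^^ n) x, (T ^^ n) y)) (s *\<^sub>R x, x) < min d (e / 2)"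
      using approx[of "min d (e / 2)" "(s *\<^sub>R x, x)"] d(1) e by auto
    then have "\<alpha> *\<^sub>C ((T ^^ n) x, (T ^^ n) y) \<notin> lines" by (intro d(2)) simp
    then have "\<not> n < N" unfolding lines_def by blast
    then have "N \<le> n" by simp
    moreover have "norm (\<alpha> *\<^sub>C (T ^^ n) x) < e"
    proof -
      have "norm (\<alpha> *\<^sub>C (T ^^ n) x - s *\<^sub>R x) < e / 2"
        using le_less_trans[OF dist_fst_le \<alpha>] by (simp add: scaleC_prod_def dist_norm)
      moreover have "norm (s *\<^sub>R x) < e / 2" using s(1,2) x by (simp add: field_simps)
      ultimately show ?thesis
        using norm_triangle_sub[of "\<alpha> *\<^sub>C (T ^^ n) x" "s *\<^sub>R x"] by simp
    qed
    moreover have "norm (\<alpha> *\<^sub>C (T ^^ n) y - x) < e"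
      using le_less_trans[OF dist_snd_le \<alpha>] e by (simp add: scaleC_prod_def dist_norm)
    ultimately show ?thesis by blast
  qed
  define good where "good k q \<longleftrightarrow> 0 < fst q \<and>
    norm (snd q *\<^sub>C (T ^^ fst q) x) < inverse (real (Suc k)) \<and>
    norm (snd q *\<^sub>C (T ^^ fst q) y - x) < inverse (real (Suc k))" for k q
  have good_late: "\<exists>q. good k q \<and> N < fst q" for k N
  proof -
    obtain i \<alpha> where "Suc N \<le> i" "norm (\<alpha> *\<^sub>C (T ^^ i) x) < inverse (real (Suc k))"
      "norm (\<alpha> *\<^sub>C (T ^^ i) y - x) < inverse (real (Suc k))"
      using late[of "inverse (real (Suc k))" "Suc N"] by auto
    then have "good k (i, \<alpha>) \<and> N < fst (i, \<alpha>)" by (simp add: good_def)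
    then show ?thesis by blast
  qed
  have "\<exists>f. \<forall>k. good k (f k) \<and> fst (f k) < fst (f (Suc k))"
    by (rule dependent_nat_choice) (use good_late in blast)+
  then obtain f where f: "\<And>k. good k (f k)" "\<And>k. fst (f k) < fst (f (Suc k))" by blast
  define n a where "n k = fst (f k)" and "a k = snd (f k)" for k
  have "strict_mono n" using f(2) by (simp add: strict_mono_Suc_iff n_def)
  then have inj: "inj n" by (rule strict_mono_imp_inj_on)
  have n_pos: "0 < n k" for k using f(1)[of k] by (simp add: good_def n_def)
  have lim_x: "(\<lambda>k. a k *\<^sub>C (T ^^ n k) x) \<longlonglongrightarrow> 0"
    using f(1) by (intro Lim_null_comparison[OF _ LIMSEQ_inverse_real_of_nat])
      (auto simp: good_def n_def a_def intro!: always_eventually less_imp_le)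
  have "(\<lambda>k. a k *\<^sub>C (T ^^ n k) y - x) \<longlonglongrightarrow> 0"
    using f(1) by (intro Lim_null_comparison[OF _ LIMSEQ_inverse_real_of_nat])
      (auto simp: good_def n_def a_def intro!: always_eventually less_imp_le)
  then have lim_y: "(\<lambda>k. a k *\<^sub>C (T ^^ n k) y) \<longlonglongrightarrow> x" by (simp add: LIM_zero_iff)
  define D where "D = {c *\<^sub>C (T ^^ m) x | c m. True}"
  have D: "closure D = UNIV" unfolding closure_UNIV_iff
  proof (intro allI impI)
    fix z and e :: real assume "0 < e"
    then obtain \<alpha> n where "dist (\<alpha> *\<^sub>C ((T ^^ n) x, (T ^^ n) y)) (z, 0) < e" using approx by blast
    from le_less_trans[OF dist_fst_le this] show "\<exists>w\<in>D. dist w z < e"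
      unfolding D_def by (auto simp: scaleC_prod_def)
  qed
  have "\<exists>c m. z = c *\<^sub>C (T ^^ m) x" if "z \<in> D" for z using that by (auto simp: D_def)
  then obtain c m where rep: "\<And>z. z \<in> D \<Longrightarrow> z = c z *\<^sub>C (T ^^ m z) x" by metis
  \<comment> \<open>\<open>inv n\<close> recovers the index from the exponent; at exponents outside the range of \<open>n\<close> the
    value is arbitrary.\<close>
  define S where "S j z = c z *\<^sub>C (T ^^ m z) (a (inv n j) *\<^sub>C y)" for j z
  have S_n: "S (n k) z = c z *\<^sub>C (T ^^ m z) (a k *\<^sub>C y)" for k z
    by (simp add: S_def inv_f_f[OF inj])
  note scale = bounded_clinear_scaleC[OF bounded_clinear_funpow[OF T]]
  have commute: "(T ^^ i) ((T ^^ j) w) = (T ^^ j) ((T ^^ i) w)" for i j w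
    by (metis add.commute comp_apply funpow_add)
  have tendsto: "(\<lambda>k. (T ^^ j) (w k)) \<longlonglongrightarrow> (T ^^ j) l" if "w \<longlonglongrightarrow> l" for w l j
    by (rule bounded_linear.tendsto[OF bounded_linear_funpow[OF T] that])
  have "(\<lambda>k. norm ((T ^^ n k) u) * norm (S (n k) z)) \<longlonglongrightarrow> 0" if "u \<in> D" "z \<in> D" for u z
  proof -
    have "norm ((T ^^ n k) u) * norm (S (n k) z) =
        cmod (c u) * cmod (c z) * norm ((T ^^ m z) y) * norm ((T ^^ m u) (a k *\<^sub>C (T ^^ n k) x))" for k
      by (subst rep[OF that(1)]) (simp add: S_n scale norm_scaleC norm_mult commute[of "n k"])
    moreover have "(\<lambda>k. norm ((T ^^ m u) (a k *\<^sub>C (T ^^ n k) x))) \<longlonglongrightarrow> norm ((T ^^ m u) 0)"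
      by (intro tendsto_norm tendsto lim_x)
    then have "(\<lambda>k. norm ((T ^^ m u) (a k *\<^sub>C (T ^^ n k) x))) \<longlonglongrightarrow> 0"
      by (simp add: linear_simps(3)[OF bounded_linear_funpow[OF T]])
    ultimately show ?thesis by (simp add: tendsto_mult_right_zero)
  qed
  moreover have "(\<lambda>k. (T ^^ n k) (S (n k) z)) \<longlonglongrightarrow> z" if "z \<in> D" for z
  proof -
    have "(T ^^ n k) (S (n k) z) = c z *\<^sub>C (T ^^ m z) (a k *\<^sub>C (T ^^ n k) y)" for k
      by (simp add: S_n scale commute[of "n k"])
    moreover have "(\<lambda>k. c z *\<^sub>C (T ^^ m z) (a k *\<^sub>C (T ^^ n k) y)) \<longlonglongrightarrow> c z *\<^sub>C (T ^^ m z) x"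
      by (intro bounded_linear.tendsto[OF bounded_linear_scaleC] tendsto lim_y)
    ultimately show ?thesis by (simp flip: rep[OF that])
  qed
  ultimately show ?thesis
    unfolding supercyclicity_criterion_def using T D n_pos by blast
qed

section \<open>The equivalence\<close>

theorem proposition3p4:
  fixes T :: "'a::complex_banach \<Rightarrow> 'a"
  assumes "separable_space (euclidean :: 'a topology)"
    and "separable_space (euclidean :: 'b::complex_banach topology)"
    and "\<exists>B :: 'b set. complex_vector.independent B \<and> complex_vector.span B = UNIV \<and>
           (finite B \<longrightarrow> 2 \<le> card B)"
    and "bounded_clinear T"
  shows "(supercyclicity_criterion T \<longleftrightarrow>
            supercyclic (tensor_id T :: ('a, 'b) ptensor \<Rightarrow> ('a, 'b) ptensor)) \<and>
         (supercyclic (tensor_id T :: ('a, 'b) ptensor \<Rightarrow> ('a, 'b) ptensor) \<longleftrightarrow>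
            supercyclic (\<lambda>(x, y). (T x, T y)))"
proof -
  have "supercyclic (tensor_id T :: ('a, 'b) ptensor \<Rightarrow> ('a, 'b) ptensor)"
    if "supercyclicity_criterion T"
    by (rule supercyclic_if_criterion[OF criterion_tensor_id[OF that]
          separable_ptensor[OF assms(1,2)]])
  moreover have "supercyclic (\<lambda>(x, y). (T x, T y))"
    if "supercyclic (tensor_id T :: ('a, 'b) ptensor \<Rightarrow> ('a, 'b) ptensor)"
    by (rule supercyclic_direct_sum_if_tensor_id[OF assms(3,4) that])
  moreover have "supercyclicity_criterion T" if "supercyclic (\<lambda>(x, y). (T x, T y))"
    by (rule criterion_if_supercyclic_direct_sum[OF assms(4) that])
  ultimately show ?thesis by blast
qed

end
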